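(* For the random graph model described in the context, with probability 1 all vertices are confirmed in the infinite DAG $\mathcal{G}(\infty):=\lim_{i\to\infty}\mathcal{G}(t_i)$ (which almost surely exists and equals $\bigcup_{i=1}^\infty\mathcal{G}(t_i)$).
   Context: **Model.** Fix an integer $M\ge 2$, integers $0<h_1<h_2<\dots<h_M$, numbers $p_{\Theta,1},\dots,p_{\Theta,M}>0$ with $\sum_k p_{\Theta,k}=1$, a finite nonempty set $I_\epsilon$ of positive integers with minimum $\epsilon_{min}$ and maximum $\epsilon_{max}$, and numbers $p_{\epsilon,j}>0$ ($j\in I_\epsilon$) with $\sum_j p_{\epsilon,j}=1$. Put $t_n:=n$; times and integers are identified. Vertices are labelled $0,1,2,\dots$; vertex $0$ is present at time $t_0$, and vertex $n\ge1$ arrives at time $t_n$. A pair $(i,j)$ denotes a directed edge from $i$ to $j$ ($j$ is then a parent of $i$). Each vertex $n\ge 1$ carries random variables $\Theta_n\in\{h_1,\dots,h_M\}$ (its proof-of-work, POW, duration), $\epsilon_n\in I_\epsilon$ (lag), and $X_n,Y_n$ (its two, possibly equal, parents). The directed graphs $\mathcal{G}(t_n)=(\mathcal{V}(t_n),\mathcal{E}(t_n))$ are defined by $\mathcal{V}(t_0)=\{0\}$, $\mathcal{E}(t_0)=\emptyset$, $$\mathcal{V}(t_{n+1})=\mathcal{V}(t_n)\cup\{k\ge1: t_k+\Theta_k=t_n\},\qquad \mathcal{E}(t_{n+1})=\mathcal{E}(t_n)\cup\{(k,X_k),(k,Y_k): k\ge 1,\ t_k+\Theta_k=t_n\},$$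 and $\mathcal{G}(t_n):=\mathcal{G}(t_0)$ for $n<0$. The set of tips is $\mathcal{L}(t_n):=\{v\in\mathcal{V}(t_n): (i,v)\notin\mathcal{E}(t_n)\text{ for all }i\}$, and $L(t_n):=|\mathcal{L}(t_n)|$. Let $\Sigma_n$ be the $\sigma$-algebra generated by $\Theta_m,\epsilon_m,X_m,Y_m$, $1\le m\le n$. The law is determined by $$\mathbb{P}(\Theta_n=h_k,\epsilon_n=j,X_n=v,Y_n=v'\mid\Sigma_{n-1})=\frac{p_{\Theta,k}\,p_{\epsilon,j}}{L(t_n-j)^2}\,1_{\{v,v'\in\mathcal{L}(t_n-j)\}}$$ for $n\ge1$, $1\le k\le M$, $j\in I_\epsilon$. **Limit.** The limit is taken in $(\mathcal{S}_*,d_* )$, where $\mathcal{S}_*$ is the space of connected DAGs rooted at vertex $0$ with all degrees finite, and $d_*(\mathcal{G}_1,\mathcal{G}_2):=(r+1)^{-1}$ with $r$ the biggest integer such that the $r$-balls around vertex $0$ in $\mathcal{G}_1$ and $\mathcal{G}_2$ are identical. **Confirmed.** A directed path from $v_n$ to $v_1$ is a sequence $(v_n,v_{n-1},\dots,v_1)$ with each $(v_{i+1},v_i)$ a directed edge. A vertex $v$ of the infinite DAG is confirmed if all but finitely many later vertices have directed paths to $v$. *)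

theory Defs
  imports
    "HOL-Probability.Probability"
    "Graph_Theory.Vertex_Walk"
    "Graph_Theory.Digraph_Component"
begin

section \<open>The tangle as a function of the proof-of-work durations and the parents\<close>

text \<open>
  The sequences \<open>\<theta>\<close>, \<open>x\<close>, \<open>y\<close> list the durations and the two parents of the vertices
  \<open>1, 2, \<dots>\<close>; their values at \<open>0\<close> are never used.
\<close>

primrec tangle_nat ::
  "(nat \<Rightarrow> nat) \<Rightarrow> (nat \<Rightarrow> nat) \<Rightarrow> (nat \<Rightarrow> nat) \<Rightarrow> nat \<Rightarrow> nat pair_pre_digraph"
where
  "tangle_nat \<theta> x y 0 = \<lparr>pverts = {0}, parcs = {}\<rparr>"
| "tangle_nat \<theta> x y (Suc n) =
     \<lparr>pverts = pverts (tangle_nat \<theta> x y n) \<union> {k. 1 \<le> k \<and> k + \<theta> k = n},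
      parcs = parcs (tangle_nat \<theta> x y n)
        \<union> (\<Union>k\<in>{k. 1 \<le> k \<and> k + \<theta> k = n}. {(k, x k), (k, y k)})\<rparr>"

text \<open>Negative times are mapped to time \<open>0\<close> by \<^const>\<open>nat\<close>.\<close>

definition tangle ::
  "(nat \<Rightarrow> nat) \<Rightarrow> (nat \<Rightarrow> nat) \<Rightarrow> (nat \<Rightarrow> nat) \<Rightarrow> int \<Rightarrow> nat pair_pre_digraph"
where
  "tangle \<theta> x y t = tangle_nat \<theta> x y (nat t)"

definition tips :: "nat pair_pre_digraph \<Rightarrow> nat set" where
  "tips G = {v \<in> pverts G. \<forall>i. (i, v) \<notin> parcs G}"

section \<open>The probabilistic model\<close>

definition random_tangle ::
  "(nat \<Rightarrow> 'a \<Rightarrow> nat) \<Rightarrow> (nat \<Rightarrow> 'a \<Rightarrow> nat) \<Rightarrow> (nat \<Rightarrow> 'a \<Rightarrow> nat) \<Rightarrow> int \<Rightarrow> 'a \<Rightarrow> nat pair_pre_digraph"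
where
  "random_tangle \<Theta> X Y t \<omega> = tangle (\<lambda>n. \<Theta> n \<omega>) (\<lambda>n. X n \<omega>) (\<lambda>n. Y n \<omega>) t"

definition history ::
  "'a measure \<Rightarrow> (nat \<Rightarrow> 'a \<Rightarrow> nat) \<Rightarrow> (nat \<Rightarrow> 'a \<Rightarrow> nat) \<Rightarrow> (nat \<Rightarrow> 'a \<Rightarrow> nat) \<Rightarrow> (nat \<Rightarrow> 'a \<Rightarrow> nat)
    \<Rightarrow> nat \<Rightarrow> 'a measure"
where
  "history P \<Theta> \<epsilon> X Y n = sigma (space P)
     (\<Union>m\<in>{1..n}. \<Union>Z\<in>{\<Theta> m, \<epsilon> m, X m, Y m}. range (\<lambda>A. Z -` A \<inter> space P))"

locale tangle_model = prob_space P
  for P :: "'a measure" +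
  fixes M :: nat and h :: "nat \<Rightarrow> nat" and p\<Theta> :: "nat \<Rightarrow> real"
    and I :: "nat set" and p\<epsilon> :: "nat \<Rightarrow> real"
    and \<Theta> \<epsilon> X Y :: "nat \<Rightarrow> 'a \<Rightarrow> nat"
  assumes M_ge_2: "2 \<le> M"
    and h_pos: "0 < h 1"
    and h_mono: "strict_mono_on {1..M} h"
    and p\<Theta>_pos: "\<And>k. k \<in> {1..M} \<Longrightarrow> 0 < p\<Theta> k"
    and p\<Theta>_sum: "(\<Sum>k\<in>{1..M}. p\<Theta> k) = 1"
    and finite_I: "finite I"
    and I_nonempty: "I \<noteq> {}"
    and I_pos: "\<And>j. j \<in> I \<Longrightarrow> 0 < j"
    and p\<epsilon>_pos: "\<And>j. j \<in> I \<Longrightarrow> 0 < p\<epsilon> j"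
    and p\<epsilon>_sum: "(\<Sum>j\<in>I. p\<epsilon> j) = 1"
    and \<Theta>_measurable: "\<And>n. 1 \<le> n \<Longrightarrow> \<Theta> n \<in> P \<rightarrow>\<^sub>M count_space (h ` {1..M})"
    and \<epsilon>_measurable: "\<And>n. 1 \<le> n \<Longrightarrow> \<epsilon> n \<in> P \<rightarrow>\<^sub>M count_space I"
    and X_measurable: "\<And>n. 1 \<le> n \<Longrightarrow> X n \<in> P \<rightarrow>\<^sub>M count_space UNIV"
    and Y_measurable: "\<And>n. 1 \<le> n \<Longrightarrow> Y n \<in> P \<rightarrow>\<^sub>M count_space UNIV"
    and law: "\<And>n k j v v'. 1 \<le> n \<Longrightarrow> k \<in> {1..M} \<Longrightarrow> j \<in> I \<Longrightarrow>
      AE \<omega> in P.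
        real_cond_exp P (history P \<Theta> \<epsilon> X Y (n - 1))
          (indicator {\<omega> \<in> space P. \<Theta> n \<omega> = h k \<and> \<epsilon> n \<omega> = j \<and> X n \<omega> = v \<and> Y n \<omega> = v'}) \<omega>
        = (let L = tips (random_tangle \<Theta> X Y (int n - int j) \<omega>)
           in p\<Theta> k * p\<epsilon> j / (real (card L))\<^sup>2 * indicator (L \<times> L) (v, v'))"

section \<open>The metric space of rooted directed acyclic graphs\<close>

definition rooted_dags :: "nat pair_pre_digraph set" where
  "rooted_dags = {G. pair_wf_digraph G \<and> 0 \<in> pverts G
     \<and> Digraph_Component.connected (with_proj G) \<and> acyclic (parcs G)
     \<and> (\<forall>v\<in>pverts G. finite (in_arcs (with_proj G) v) \<and> finite (out_arcs (with_proj G) v))}"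

text \<open>
  The ball of radius \<open>r\<close> is the induced subgraph on the vertices whose undirected graph
  distance to the root is at most \<open>r\<close>.
\<close>

definition root_ball_verts :: "nat pair_pre_digraph \<Rightarrow> nat \<Rightarrow> nat set" where
  "root_ball_verts G r = {v. \<exists>p. vwalk p (with_proj (mk_symmetric (with_proj G)))
     \<and> hd p = 0 \<and> last p = v \<and> vwalk_length p \<le> r}"

definition root_ball :: "nat pair_pre_digraph \<Rightarrow> nat \<Rightarrow> (nat, nat \<times> nat) pre_digraph" where
  "root_ball G r = with_proj G \<restriction> root_ball_verts G r"

text \<open>Two graphs all of whose balls agree have distance \<open>0\<close>.\<close>

definition dag_dist :: "nat pair_pre_digraph \<Rightarrow> nat pair_pre_digraph \<Rightarrow> real" where
  "dag_dist G H = (if \<forall>r. root_ball G r = root_ball H r then 0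
     else inverse (real (GREATEST r. root_ball G r = root_ball H r) + 1))"

lemma root_ball_verts_subset: "root_ball_verts G r \<subseteq> pverts G"
proof
  fix v assume "v \<in> root_ball_verts G r"
  then obtain p where p: "vwalk p (with_proj (mk_symmetric (with_proj G)))" "last p = v"
    unfolding root_ball_verts_def by blast
  then have "p \<noteq> []" "set p \<subseteq> pverts G" by (simp_all add: vwalk_def mk_symmetric_def)
  then show "v \<in> pverts G" using p(2) last_in_set by blast
qed

lemma root_ball_verts_mono: "s \<le> r \<Longrightarrow> root_ball_verts G s \<subseteq> root_ball_verts G r"
  unfolding root_ball_verts_def by (blast intro: order_trans)

lemma root_ball_verts_0:
  assumes "G \<in> rooted_dags"
  shows "root_ball_verts G 0 = {0}"
proof -
  have "vwalk [0] (with_proj (mk_symmetric (with_proj G)))"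
    using assms by (auto simp: rooted_dags_def vwalk_def mk_symmetric_def)
  then have "0 \<in> root_ball_verts G 0"
    unfolding root_ball_verts_def by (intro CollectI exI[of _ "[0]"]) simp
  moreover have "v = 0" if v: "v \<in> root_ball_verts G 0" for v
  proof -
    obtain p :: "nat list" where p: "p \<noteq> []" "hd p = 0" "last p = v" "length p - 1 = 0"
      using v unfolding root_ball_verts_def vwalk_def by auto
    then show "v = 0" by (cases p) auto
  qed
  ultimately show ?thesis by blast
qed

lemma root_ball_0:
  assumes "G \<in> rooted_dags"
  shows "root_ball G 0 = \<lparr>verts = {0}, arcs = {}, tail = fst, head = snd\<rparr>"
  using assms root_ball_verts_0[OF assms]
  by (auto simp: root_ball_def induce_subgraph_def rooted_dags_def acyclic_def)

lemma vwalk_arcs_verts: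
  "(a, b) \<in> set (vwalk_arcs p) \<Longrightarrow> a \<in> set p \<and> b \<in> set p"
  by (induction p rule: vwalk_arcs.induct) auto

lemma vwalk_arcs_take: "set (vwalk_arcs (take n p)) \<subseteq> set (vwalk_arcs p)"
proof (induction p arbitrary: n rule: vwalk_arcs.induct)
  case (3 x y xs)
  show ?case
  proof (cases n)
    case (Suc m)
    then show ?thesis using "3.IH"[of m] by (cases m) auto
  qed simp
qed (auto simp: take_Cons split: nat.splits)

lemma root_ball_verts_walk:
  assumes "vwalk p (with_proj (mk_symmetric (with_proj G)))" "hd p = 0" "vwalk_length p \<le> r"
  shows "set p \<subseteq> root_ball_verts G r"
proof
  fix v assume "v \<in> set p"
  then obtain i where i: "i < length p" "p ! i = v" by (auto simp: in_set_conv_nth)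
  let ?q = "take (Suc i) p"
  have "vwalk ?q (with_proj (mk_symmetric (with_proj G)))"
    using assms(1) i vwalk_arcs_take[of "Suc i" p] set_take_subset[of "Suc i" p]
    unfolding vwalk_def by force
  moreover have "hd ?q = 0" using assms(2) by simp
  moreover have "last ?q = v" using i by (simp add: take_Suc_conv_app_nth)
  moreover have "vwalk_length ?q \<le> r" using assms(3) i by simp
  ultimately show "v \<in> root_ball_verts G r" unfolding root_ball_verts_def by blast
qed

lemma root_ball_verts_mono_subset:
  assumes "root_ball G r = root_ball H r" "s \<le> r"
  shows "root_ball_verts G s \<subseteq> root_ball_verts H s"
proof
  fix v assume "v \<in> root_ball_verts G s"
  then obtain p where p: "vwalk p (with_proj (mk_symmetric (with_proj G)))" "hd p = 0"
      "last p = v" "vwalk_length p \<le> s"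
    unfolding root_ball_verts_def by blast
  have V: "root_ball_verts G r = root_ball_verts H r"
    using arg_cong[OF assms(1), of verts] by (simp add: root_ball_def)
  have A: "(a, b) \<in> parcs H" if "(a, b) \<in> parcs G"
      "a \<in> root_ball_verts G r" "b \<in> root_ball_verts G r" for a b
  proof -
    have "(a, b) \<in> arcs (root_ball G r)"
      using that by (simp add: root_ball_def induce_subgraph_def)
    then show ?thesis
      unfolding assms(1) by (simp add: root_ball_def induce_subgraph_def)
  qed
  have sub: "set p \<subseteq> root_ball_verts G r"
    using root_ball_verts_walk[OF p(1,2)] p(4) assms(2) by simp
  have "set p \<subseteq> pverts (mk_symmetric (with_proj H))"
  proof
    fix u assume "u \<in> set p"
    then have "u \<in> root_ball_verts H r" using sub V by blast
    then show "u \<in> pverts (mk_symmetric (with_proj H))"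
      using root_ball_verts_subset[of H r] by (auto simp: mk_symmetric_def)
  qed
  moreover have "set (vwalk_arcs p) \<subseteq> parcs (mk_symmetric (with_proj H))"
  proof
    fix e assume e: "e \<in> set (vwalk_arcs p)"
    obtain a b where ab: "e = (a, b)" by (cases e)
    have ends: "a \<in> root_ball_verts G r" "b \<in> root_ball_verts G r"
      using vwalk_arcs_verts[of a b p] e sub unfolding ab by (auto dest: subsetD)
    have sym: "(c, d) \<in> parcs (mk_symmetric (with_proj F)) \<longleftrightarrow>
        (c, d) \<in> parcs F \<or> (d, c) \<in> parcs F" for c d F
    proof -
      have "(c, d) \<in> parcs (mk_symmetric (with_proj F)) \<longleftrightarrow>
          (\<exists>x y. (x, y) \<in> parcs F \<and> ((c, d) = (x, y) \<or> (c, d) = (y, x)))"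
        by (simp add: mk_symmetric_def Bex_def split_paired_Ex)
      then show ?thesis by blast
    qed
    have "(a, b) \<in> parcs (mk_symmetric (with_proj G))"
      using p(1) e unfolding ab vwalk_def with_proj_simps by blast
    then show "e \<in> parcs (mk_symmetric (with_proj H))"
      unfolding ab sym using A ends by blast
  qed
  ultimately have "vwalk p (with_proj (mk_symmetric (with_proj H)))"
    using p(1) by (simp add: vwalk_def)
  then show "v \<in> root_ball_verts H s"
    unfolding root_ball_verts_def using p(2,3,4) by (intro CollectI exI[of _ p] conjI)
qed

lemma root_ball_eq_mono:
  assumes "root_ball G r = root_ball H r" "s \<le> r"
  shows "root_ball G s = root_ball H s"
proof -
  have V: "root_ball_verts G s = root_ball_verts H s"
    using root_ball_verts_mono_subset[OF assms] root_ball_verts_mono_subset[OF assms(1)[symmetric] assms(2)]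
    by blast
  have sub: "root_ball_verts F s \<subseteq> root_ball_verts F r" for F
    using assms(2) by (rule root_ball_verts_mono)
  have "{e \<in> parcs G. fst e \<in> root_ball_verts G r \<and> snd e \<in> root_ball_verts G r}
      = {e \<in> parcs H. fst e \<in> root_ball_verts H r \<and> snd e \<in> root_ball_verts H r}"
    using arg_cong[OF assms(1), of arcs] by (simp add: root_ball_def induce_subgraph_def)
  then have "{e \<in> parcs G. fst e \<in> root_ball_verts G s \<and> snd e \<in> root_ball_verts G s}
      = {e \<in> parcs H. fst e \<in> root_ball_verts G s \<and> snd e \<in> root_ball_verts G s}"
    using sub[of G] sub[of H] V by blast
  then show ?thesis
    using V by (simp add: root_ball_def induce_subgraph_def)
qed

lemma dag_dist_le_iff:
  assumes "G \<in> rooted_dags" "H \<in> rooted_dags"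
  shows "dag_dist G H \<le> inverse (real r + 1) \<longleftrightarrow> root_ball G r = root_ball H r"
proof (cases "\<forall>r. root_ball G r = root_ball H r")
  case True
  then show ?thesis by (simp add: dag_dist_def)
next
  case False
  let ?P = "\<lambda>r. root_ball G r = root_ball H r"
  from False obtain b where "\<not> ?P b" by blast
  then have b: "\<And>s. ?P s \<Longrightarrow> s \<le> b" using root_ball_eq_mono nat_le_linear by blast
  have "?P 0" using assms by (simp add: root_ball_0)
  then have g: "?P (Greatest ?P)" using b by (rule GreatestI_nat)
  have "dag_dist G H \<le> inverse (real r + 1) \<longleftrightarrow> r \<le> Greatest ?P"
    unfolding dag_dist_def if_not_P[OF False] by simp
  also have "\<dots> \<longleftrightarrow> ?P r"
    using g b root_ball_eq_mono Greatest_le_nat[of ?P r b] by blast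
  finally show ?thesis .
qed

lemma root_ball_verts_exhaust:
  assumes "G \<in> rooted_dags"
  shows "pverts G = (\<Union>r. root_ball_verts G r)"
proof
  let ?S = "with_proj (mk_symmetric (with_proj G))"
  have "v \<in> (\<Union>r. root_ball_verts G r)" if "0 \<rightarrow>\<^sup>*\<^bsub>?S\<^esub> v" for v
    using that unfolding reachable_def
  proof (induction rule: rtrancl_on_induct)
    case base
    then show ?case using assms root_ball_verts_0 by blast
  next
    case (step u w)
    then obtain r p where p: "vwalk p ?S" "hd p = 0" "last p = u" "vwalk_length p \<le> r"
      unfolding root_ball_verts_def by blast
    have arcs_app: "set (vwalk_arcs (q @ [w])) = insert (last q, w) (set (vwalk_arcs q))"
      if "q \<noteq> []" for q :: "nat list"
      using that by (induction q rule: vwalk_arcs.induct) auto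
    have "vwalk (p @ [w]) ?S"
      using p step arcs_app[of p] by (auto simp: vwalk_def)
    moreover have "hd (p @ [w]) = 0" using p by (auto simp: vwalk_def)
    moreover have "vwalk_length (p @ [w]) \<le> Suc r" using p by simp
    ultimately have "w \<in> root_ball_verts G (Suc r)"
      unfolding root_ball_verts_def by (metis (mono_tags, lifting) last_snoc mem_Collect_eq)
    then show ?case by blast
  qed
  then show "pverts G \<subseteq> (\<Union>r. root_ball_verts G r)"
    using assms
    by (auto simp: rooted_dags_def Digraph_Component.connected_def strongly_connected_def
        mk_symmetric_def)
  show "(\<Union>r. root_ball_verts G r) \<subseteq> pverts G"
    using root_ball_verts_subset by blast
qed

lemma rooted_dags_eqI:
  assumes "G \<in> rooted_dags" "H \<in> rooted_dags" "\<And>r. root_ball G r = root_ball H r"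
  shows "G = H"
proof -
  have V: "root_ball_verts G r = root_ball_verts H r" for r
    using arg_cong[OF assms(3), of verts] by (simp add: root_ball_def)
  have sub: "parcs G \<subseteq> parcs H"
    if GH: "G \<in> rooted_dags" "\<And>r. root_ball G r = root_ball H r" for G H
  proof
    fix e assume e: "e \<in> parcs G"
    have wf: "pair_wf_digraph G" using GH by (simp add: rooted_dags_def)
    then have "fst e \<in> pverts G" "snd e \<in> pverts G"
      using e by (simp_all add: pair_wf_digraph.arc_fst_in_verts pair_wf_digraph.arc_snd_in_verts)
    then obtain r s where "fst e \<in> root_ball_verts G r" "snd e \<in> root_ball_verts G s"
      using root_ball_verts_exhaust[OF GH(1)] by blast
    moreover have "root_ball_verts G k \<subseteq> root_ball_verts G (max r s)" if "k \<in> {r, s}" for k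
      using that root_ball_verts_mono[of k "max r s" G] by auto
    ultimately have "e \<in> arcs (root_ball G (max r s))"
      using e by (auto simp: root_ball_def induce_subgraph_def)
    then show "e \<in> parcs H"
      unfolding GH(2) by (simp add: root_ball_def induce_subgraph_def)
  qed
  have "parcs G = parcs H" using sub[of G H] sub[of H G] assms by auto
  moreover have "pverts G = pverts H" using V assms by (simp add: root_ball_verts_exhaust)
  ultimately show ?thesis by simp
qed

interpretation dag_space: Metric_space rooted_dags dag_dist
proof
  fix G H show "0 \<le> dag_dist G H" by (simp add: dag_dist_def)
next
  fix G H show "dag_dist G H = dag_dist H G" 
    unfolding dag_dist_def by (simp add: eq_commute[of "root_ball G _"])
next
  fix G H assume GH: "G \<in> rooted_dags" "H \<in> rooted_dags"
  have "root_ball G r = root_ball H r" if "dag_dist G H = 0" for r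
    using dag_dist_le_iff[OF GH] that by simp
  then have "G = H" if "dag_dist G H = 0" using rooted_dags_eqI[OF GH] that by blast
  moreover have "dag_dist H H = 0" by (simp add: dag_dist_def)
  ultimately show "dag_dist G H = 0 \<longleftrightarrow> G = H" by blast
next
  fix F G H assume FGH: "F \<in> rooted_dags" "G \<in> rooted_dags" "H \<in> rooted_dags"
  let ?m = "max (dag_dist F G) (dag_dist G H)"
  have nonneg: "0 \<le> dag_dist A B" for A B by (simp add: dag_dist_def)
  have step: "dag_dist F H \<le> inverse (real r + 1)" if "?m \<le> inverse (real r + 1)" for r
    using that dag_dist_le_iff FGH by simp
  have "dag_dist F H \<le> ?m"
  proof (cases "?m = 0")
    case True
    then have "dag_dist F H \<le> inverse (real r + 1)" for r using step by simp
    then have "\<forall>r. root_ball F r = root_ball H r" using dag_dist_le_iff FGH by simp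
    then have "dag_dist F H = 0" by (simp add: dag_dist_def)
    then show ?thesis using True by simp
  next
    case False
    then obtain r where "?m = inverse (real r + 1)"
      unfolding dag_dist_def max_def by (auto split: if_splits)
    then show ?thesis using step by simp
  qed
  then show "dag_dist F H \<le> dag_dist F G + dag_dist G H"
    using nonneg[of F G] nonneg[of G H] by linarith
qed

section \<open>The infinite graph and confirmation\<close>

definition converges_to :: "(nat \<Rightarrow> nat pair_pre_digraph) \<Rightarrow> nat pair_pre_digraph \<Rightarrow> bool" where
  "converges_to g H \<longleftrightarrow> limitin dag_space.mtopology g H sequentially"

text \<open>Limits are unique, so this is the limit whenever \<open>g\<close> converges.\<close>

definition dag_lim :: "(nat \<Rightarrow> nat pair_pre_digraph) \<Rightarrow> nat pair_pre_digraph" where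
  "dag_lim g = (THE H. converges_to g H)"

lemma dag_lim_eq: "converges_to g H \<Longrightarrow> dag_lim g = H"
  unfolding dag_lim_def converges_to_def
  using dag_space.limitin_metric_unique trivial_limit_sequentially by blast

definition directed_path :: "nat pair_pre_digraph \<Rightarrow> nat \<Rightarrow> nat \<Rightarrow> bool" where
  "directed_path G w v \<longleftrightarrow> (\<exists>p. vwalk p (with_proj G) \<and> hd p = w \<and> last p = v)"

text \<open>Labels are arrival times, so the later vertices are those with a larger label.\<close>

definition confirmed :: "nat pair_pre_digraph \<Rightarrow> nat \<Rightarrow> bool" where
  "confirmed G v \<longleftrightarrow> finite {w \<in> pverts G. v < w \<and> \<not> directed_path G w v}"

end

theory Submission
  imports Defs
begin

text \<open>Let \<open>U n\<close> be the number of vertices up to \<open>n\<close> that no vertex up to \<open>n\<close> has picked as a parent. It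
  differs from the number of tips seen by the next vertex by a constant at most. The next vertex
  adds one to \<open>U n\<close> and subtracts the number of its distinct parents that had not been picked before,
  so that \<open>U n\<close> has drift at most \<open>-1/2\<close> as long as it is large.

  Fix a vertex \<open>v\<close>. Among the tips seen by a new vertex there is always one that leads to \<open>v\<close>. While
  \<open>U n\<close> is bounded, there is a probability bounded below that, for a fixed number of steps, every new
  vertex picks such a tip as its first parent and, if possible, a not yet picked vertex that does not
  lead to \<open>v\<close> as its second. Then the tips that do not lead to \<open>v\<close> die out for good, and \<open>v\<close> is
  confirmed. A Lyapunov function combining \<open>U n\<close> with the probability that this has not happened yet
  shows that it happens almost surely.

  The convergence needs no probability: a vertex that has been referenced stops being a tip, so all
  degrees are finite and every ball around the root is eventually constant.\<close>

section \<open>Rooted balls and convergence\<close>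

lemma parcs_mk_symmetric_with_proj:
  "(u, w) \<in> parcs (mk_symmetric (with_proj G)) \<longleftrightarrow> (u, w) \<in> parcs G \<or> (w, u) \<in> parcs G"
  by (auto simp: parcs_mk_symmetric Bex_def split_paired_Ex)

lemma set_vwalk_arcs_snoc:
  "p \<noteq> [] \<Longrightarrow> set (vwalk_arcs (p @ [w])) = insert (last p, w) (set (vwalk_arcs p))"
  by (induction p rule: vwalk_arcs.induct) auto

text \<open>Splitting off the last vertex of a walk turns balls into iterated neighbourhoods, so
  that later arguments can proceed by induction on the radius.\<close>

lemma root_ball_verts_Suc:
  assumes "pair_wf_digraph G"
  shows "root_ball_verts G (Suc r) = root_ball_verts G r
    \<union> {w. \<exists>u\<in>root_ball_verts G r. (u, w) \<in> parcs G \<or> (w, u) \<in> parcs G}"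
    (is "_ = ?R")
proof (intro equalityI subsetI)
  let ?S = "with_proj (mk_symmetric (with_proj G))"
  fix v assume "v \<in> root_ball_verts G (Suc r)"
  then obtain p where p: "vwalk p ?S" "hd p = 0" "last p = v" "length p \<le> Suc (Suc r)"
    unfolding root_ball_verts_def by auto
  have "p \<noteq> []" using p(1) by (auto simp: vwalk_def)
  then obtain q where q: "p = q @ [v]" using p(3) by (metis append_butlast_last_id)
  show "v \<in> ?R"
  proof (cases "q = []")
    case True
    then have "v \<in> root_ball_verts G r"
      using p q unfolding root_ball_verts_def by (intro CollectI exI[of _ p]) auto
    then show ?thesis by blast
  next
    case False
    have arcs: "set (vwalk_arcs p) = insert (last q, v) (set (vwalk_arcs q))"
      unfolding q by (rule set_vwalk_arcs_snoc[OF False])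
    have "vwalk q ?S" using p(1) arcs False unfolding vwalk_def q by auto
    then have "last q \<in> root_ball_verts G r"
      using p q False unfolding root_ball_verts_def by (intro CollectI exI[of _ q]) auto
    moreover have "(last q, v) \<in> parcs G \<or> (v, last q) \<in> parcs G"
      using p(1) arcs unfolding vwalk_def by (auto simp flip: parcs_mk_symmetric_with_proj)
    ultimately show ?thesis by blast
  qed
next
  let ?S = "with_proj (mk_symmetric (with_proj G))"
  interpret pair_wf_digraph G by fact
  fix w assume "w \<in> ?R"
  then consider "w \<in> root_ball_verts G r"
    | u where "u \<in> root_ball_verts G r" "(u, w) \<in> parcs G \<or> (w, u) \<in> parcs G" by blast
  then show "w \<in> root_ball_verts G (Suc r)"
  proof cases
    case 1
    then show ?thesis using root_ball_verts_mono[of r "Suc r" G] by auto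
  next
    case 2
    then obtain p where p: "vwalk p ?S" "hd p = 0" "last p = u" "length p \<le> Suc r"
      unfolding root_ball_verts_def by auto
    have ne: "p \<noteq> []" using p(1) by (auto simp: vwalk_def)
    have "(u, w) \<in> parcs (mk_symmetric (with_proj G))"
      using 2(2) by (simp only: parcs_mk_symmetric_with_proj)
    moreover have "w \<in> pverts G" using 2(2) in_arcsD1 in_arcsD2 by blast
    ultimately have "vwalk (p @ [w]) ?S"
      using p set_vwalk_arcs_snoc[OF ne, of w] by (auto simp: vwalk_def)
    then show ?thesis
      using p ne unfolding root_ball_verts_def by (intro CollectI exI[of _ "p @ [w]"]) auto
  qed
qed

text \<open>Arcs lower the label. This gives acyclicity and finite out-degrees at once, and it lets
  strong induction on the label follow outgoing arcs down to the root, which yields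
  connectedness.\<close>

lemma rooted_dagsI:
  assumes "0 \<in> pverts G"
    and arc: "\<And>u w. (u, w) \<in> parcs G \<Longrightarrow> u \<in> pverts G \<and> w \<in> pverts G \<and> w < u"
    and out: "\<And>u. u \<in> pverts G \<Longrightarrow> u \<noteq> 0 \<Longrightarrow> \<exists>w. (u, w) \<in> parcs G"
    and fin: "\<And>v. v \<in> pverts G \<Longrightarrow> finite {u. (u, v) \<in> parcs G}"
  shows "G \<in> rooted_dags"
proof -
  interpret pair_wf_digraph G
    using arc by unfold_locales (auto simp: split_paired_all)
  interpret S: pair_wf_digraph "mk_symmetric (with_proj G)"
    by (rule wellformed_mk_symmetric)
  have to_root: "u \<rightarrow>\<^sup>*\<^bsub>mk_symmetric (with_proj G)\<^esub> 0 \<and> 0 \<rightarrow>\<^sup>*\<^bsub>mk_symmetric (with_proj G)\<^esub> u"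
    if "u \<in> pverts G" for u
    using that
  proof (induction u rule: less_induct)
    case (less u)
    show ?case
    proof (cases "u = 0")
      case True
      then show ?thesis using less.prems by simp
    next
      case False
      then obtain w where w: "(u, w) \<in> parcs G" using out less.prems by blast
      then have *: "(u, w) \<in> parcs (mk_symmetric (with_proj G))"
        "(w, u) \<in> parcs (mk_symmetric (with_proj G))"
        by (simp_all only: parcs_mk_symmetric_with_proj simp_thms)
      show ?thesis
        using less.IH[of w] arc[OF w] S.adj_reachable_trans[of u w 0] S.reachable_adj_trans[of 0 w u] *
        by auto
    qed
  qed
  have "Digraph_Component.connected (with_proj G)"
    unfolding Digraph_Component.connected_def strongly_connected_def
    using to_root assms(1) by (auto intro: S.reachable_trans[of _ 0])
  moreover have "parcs G \<subseteq> {(u, w). w < u}" using arc by auto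
  then have "acyclic (parcs G)"
    by (intro acyclic_subset[OF acyclicI_order[where f = "\<lambda>x. x"]]) auto
  moreover have "finite (in_arcs (with_proj G) v)" if "v \<in> pverts G" for v
    by (rule finite_subset[of _ "{u. (u, v) \<in> parcs G} \<times> {v}"]) (use fin[OF that] in \<open>auto simp: in_arcs_def\<close>)
  moreover have "finite (out_arcs (with_proj G) v)" for v
    by (rule finite_subset[of _ "{v} \<times> {..<v}"]) (use arc in \<open>auto simp: out_arcs_def\<close>)
  ultimately show ?thesis
    unfolding rooted_dags_def using assms(1) by (auto intro: pair_wf_digraph_axioms)
qed

lemma finite_root_ball_verts:
  assumes "G \<in> rooted_dags"
  shows "finite (root_ball_verts G r)"
proof (induction r)
  case 0
  show ?case using root_ball_verts_0[OF assms] by simp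
next
  case (Suc r)
  have wf: "pair_wf_digraph G" using assms by (simp add: rooted_dags_def)
  have "finite {w. (u, w) \<in> parcs G \<or> (w, u) \<in> parcs G}" if "u \<in> root_ball_verts G r" for u
  proof (rule finite_subset)
    show "{w. (u, w) \<in> parcs G \<or> (w, u) \<in> parcs G}
        \<subseteq> snd ` out_arcs (with_proj G) u \<union> fst ` in_arcs (with_proj G) u"
      by (force simp: out_arcs_def in_arcs_def)
    show "finite (snd ` out_arcs (with_proj G) u \<union> fst ` in_arcs (with_proj G) u)"
      using assms root_ball_verts_subset[of G r] that by (auto simp: rooted_dags_def)
  qed
  moreover have "root_ball_verts G (Suc r) = root_ball_verts G r
      \<union> (\<Union>u\<in>root_ball_verts G r. {w. (u, w) \<in> parcs G \<or> (w, u) \<in> parcs G})"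
    unfolding root_ball_verts_Suc[OF wf] by blast
  ultimately show ?case using Suc by simp
qed

text \<open>All degrees of \<open>G\<close> are finite, so only finitely many arcs of
  \<open>G\<close> touch a given ball, and from some index on all of them are present in
  \<open>g i\<close>. By induction on the radius the vertex sets of the balls then agree, and after
  that the induced arcs.\<close>

lemma eventually_root_ball_eq:
  assumes dags: "\<And>i. g i \<in> rooted_dags" and G: "G \<in> rooted_dags"
    and arcs: "parcs G = (\<Union>i. parcs (g i))" and mono: "\<And>i j. i \<le> j \<Longrightarrow> parcs (g i) \<subseteq> parcs (g j)"
  shows "\<forall>\<^sub>F i in sequentially. root_ball (g i) r = root_ball G r"
proof -
  have wf: "pair_wf_digraph G" "pair_wf_digraph (g i)" for i
    using dags G by (auto simp: rooted_dags_def)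
  have in_degree: "finite {u. (u, v) \<in> parcs G}" if "v \<in> pverts G" for v
    by (rule finite_subset[of _ "fst ` in_arcs (with_proj G) v"])
      (use that G in \<open>force simp: in_arcs_def\<close>, use that G in \<open>simp add: rooted_dags_def\<close>)
  have fin_arcs: "finite {e \<in> parcs G. snd e \<in> B}" if "finite B" for B
  proof -
    have "{e \<in> parcs G. snd e \<in> B} \<subseteq> (\<Union>v\<in>B \<inter> pverts G. {u. (u, v) \<in> parcs G} \<times> {v})"
      using pair_wf_digraph.in_arcsD2[OF wf(1)] by auto
    then show ?thesis
      by (rule finite_subset) (use that in_degree in auto)
  qed
  \<comment> \<open>Monotonicity turns membership in the union into membership from some index on;
    finiteness of \<open>A\<close> makes that index uniform.\<close>
  have ev: "\<forall>\<^sub>F i in sequentially. \<forall>e\<in>A. e \<in> parcs (g i)" if A: "finite A" "A \<subseteq> parcs G" for A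
  proof (rule eventually_ball_finite[OF A(1)], rule ballI)
    fix e assume "e \<in> A"
    then obtain i where "e \<in> parcs (g i)" using A(2) arcs by auto
    then show "\<forall>\<^sub>F i in sequentially. e \<in> parcs (g i)"
      using mono unfolding eventually_sequentially by blast
  qed
  have out: "finite {e \<in> parcs G. fst e \<in> B}" if "finite B" for B
  proof (rule finite_subset)
    show "{e \<in> parcs G. fst e \<in> B} \<subseteq> (\<Union>u\<in>B \<inter> pverts G. out_arcs (with_proj G) u)"
      using pair_wf_digraph.in_arcsD1[OF wf(1)] by (auto simp: out_arcs_def)
    show "finite (\<Union>u\<in>B \<inter> pverts G. out_arcs (with_proj G) u)"
      using that G by (auto simp: rooted_dags_def)
  qed
  have sub: "parcs (g i) \<subseteq> parcs G" for i using arcs by blast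
  have verts: "\<forall>\<^sub>F i in sequentially. root_ball_verts (g i) r = root_ball_verts G r" for r
  proof (induction r)
    case 0
    show ?case using root_ball_verts_0 dags G by simp
  next
    case (Suc r)
    let ?B = "root_ball_verts G r"
    have "\<forall>\<^sub>F i in sequentially. \<forall>e\<in>{e \<in> parcs G. fst e \<in> ?B} \<union> {e \<in> parcs G. snd e \<in> ?B}. e \<in> parcs (g i)"
      by (rule ev) (auto intro: fin_arcs out finite_root_ball_verts[OF G])
    with Suc show ?case
    proof eventually_elim
      case (elim i)
      have "(u, w) \<in> parcs (g i) \<longleftrightarrow> (u, w) \<in> parcs G" if "u \<in> ?B \<or> w \<in> ?B" for u w
        using elim(2) sub[of i] that by auto
      then show ?case
        unfolding root_ball_verts_Suc[OF wf(1)] root_ball_verts_Suc[OF wf(2)] elim(1) by blast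
    qed
  qed
  have "\<forall>\<^sub>F i in sequentially. \<forall>e\<in>{e \<in> parcs G. fst e \<in> root_ball_verts G r}. e \<in> parcs (g i)"
    by (rule ev) (auto intro: out finite_root_ball_verts[OF G])
  with verts[of r] show ?thesis
  proof eventually_elim
    case (elim i)
    then have "{e \<in> parcs (g i). fst e \<in> root_ball_verts G r \<and> snd e \<in> root_ball_verts G r}
      = {e \<in> parcs G. fst e \<in> root_ball_verts G r \<and> snd e \<in> root_ball_verts G r}"
      using sub[of i] by auto
    then show ?case
      unfolding root_ball_def induce_subgraph_def elim(1) by simp
  qed
qed

text \<open>Agreement on the ball of radius \<open>r\<close> bounds the distance by
  \<open>1 / (r + 1)\<close>, so eventual agreement on every ball is convergence.\<close>

lemma converges_to_increasing_union:
  assumes dags: "\<And>i. g i \<in> rooted_dags" and G: "G \<in> rooted_dags"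
    and "parcs G = (\<Union>i. parcs (g i))" "\<And>i j. i \<le> j \<Longrightarrow> parcs (g i) \<subseteq> parcs (g j)"
  shows "converges_to g G"
  unfolding converges_to_def dag_space.limitin_metric
proof (intro conjI allI impI)
  show "G \<in> rooted_dags" by fact
next
  fix e :: real assume "0 < e"
  then obtain r where r: "inverse (real (Suc r)) < e" using reals_Archimedean by blast
  have "\<forall>\<^sub>F i in sequentially. root_ball (g i) r = root_ball G r"
    by (rule eventually_root_ball_eq) fact+
  then show "\<forall>\<^sub>F i in sequentially. g i \<in> rooted_dags \<and> dag_dist (g i) G < e"
  proof eventually_elim
    case (elim i)
    then have "dag_dist (g i) G \<le> inverse (real r + 1)"
      using dag_dist_le_iff dags G by blast
    then show ?case using r dags by (simp add: add.commute)
  qed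
qed

lemma rtrancl_imp_directed_path:
  assumes "(w, v) \<in> (parcs G)\<^sup>*" "w \<in> pverts G" "pair_wf_digraph G"
  shows "directed_path G w v"
proof -
  interpret pair_wf_digraph G by fact
  show ?thesis using assms(1)
  proof (induction rule: rtrancl_induct)
    case base
    then show ?case unfolding directed_path_def using assms(2) by (intro exI[of _ "[w]"]) (auto simp: vwalk_def)
  next
    case (step u z)
    then obtain p where p: "vwalk p (with_proj G)" "hd p = w" "last p = u"
      unfolding directed_path_def by blast
    have ne: "p \<noteq> []" using p(1) by (auto simp: vwalk_def)
    show ?case unfolding directed_path_def
      using p ne set_vwalk_arcs_snoc[OF ne, of z] step(2) in_arcsD2[OF step(2)]
      by (intro exI[of _ "p @ [z]"]) (auto simp: vwalk_def)
  qed
qed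

section \<open>The graph seen by a new vertex\<close>

text \<open>The inequality is strict because a proof of work that ends at time \<open>n\<close>
  enters the graph only at time \<open>n + 1\<close>.\<close>

lemma tangle_nat_closed_form:
  "pverts (tangle_nat \<theta> x y t) = insert 0 {k. 1 \<le> k \<and> k + \<theta> k < t}"
  "parcs (tangle_nat \<theta> x y t)
    = (\<Union>k\<in>{k. 1 \<le> k \<and> k + \<theta> k < t}. {(k, x k), (k, y k)})"
  by (induction t) (auto simp: less_Suc_eq)

text \<open>A vertex present at time \<open>t\<close> has a label below \<open>t\<close>, so later
  choices cannot matter. This is the source of all adaptedness results below.\<close>

lemma tangle_nat_cong:
  assumes "\<And>k. 1 \<le> k \<Longrightarrow> k < t \<Longrightarrow> \<theta> k = \<theta>' k \<and> x k = x' k \<and> y k = y' k"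
  shows "tangle_nat \<theta> x y t = tangle_nat \<theta>' x' y' t"
proof -
  have "1 \<le> k \<and> k + \<theta> k < t \<longleftrightarrow> 1 \<le> k \<and> k + \<theta>' k < t" for k
    using assms[of k] by (cases "k < t") auto
  then have "{k. 1 \<le> k \<and> k + \<theta> k < t} = {k. 1 \<le> k \<and> k + \<theta>' k < t}" by blast
  moreover have "(\<Union>k\<in>{k. 1 \<le> k \<and> k + \<theta>' k < t}. {(k, x k), (k, y k)})
      = (\<Union>k\<in>{k. 1 \<le> k \<and> k + \<theta>' k < t}. {(k, x' k), (k, y' k)})"
    by (intro SUP_cong refl) (use assms in auto)
  ultimately show ?thesis
    by (intro pair_pre_digraph.equality) (simp_all add: tangle_nat_closed_form)
qed

text \<open>Truncated subtraction implements the convention that negative times stand for time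
  0.\<close>

definition visible_tips :: "(nat \<Rightarrow> nat) \<Rightarrow> (nat \<Rightarrow> nat) \<Rightarrow> (nat \<Rightarrow> nat) \<Rightarrow> nat \<Rightarrow> nat \<Rightarrow> nat set" where
  "visible_tips \<theta> x y n j = tips (tangle_nat \<theta> x y (n - j))"

lemma visible_tips_cong:
  assumes "\<And>k. 1 \<le> k \<Longrightarrow> k < n \<Longrightarrow> \<theta> k = \<theta>' k \<and> x k = x' k \<and> y k = y' k"
  shows "visible_tips \<theta> x y n j = visible_tips \<theta>' x' y' n j"
  unfolding visible_tips_def
  by (rule arg_cong[where f = tips], rule tangle_nat_cong) (use assms in auto)

lemma mem_tips_tangle_nat_iff:
  "p \<in> tips (tangle_nat \<theta> x y t) \<longleftrightarrow>
    (p = 0 \<or> p + \<theta> p < t) \<and> (\<forall>k. 1 \<le> k \<longrightarrow> k + \<theta> k < t \<longrightarrow> x k \<noteq> p \<and> y k \<noteq> p)"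
  by (auto simp: tips_def tangle_nat_closed_form)

lemma finite_tips_tangle_nat: "finite (tips (tangle_nat \<theta> x y t))"
  by (rule finite_subset[of _ "{..t}"]) (auto simp: mem_tips_tangle_nat_iff)

text \<open>References count from the moment they are chosen, even while the proof of work is still
  running. This makes the one-step change simple, unlike that of the tips, which react with a
  delay.\<close>

definition unreferenced :: "(nat \<Rightarrow> nat) \<Rightarrow> (nat \<Rightarrow> nat) \<Rightarrow> nat \<Rightarrow> nat set" where
  "unreferenced x y n = {..n} - (x ` {1..n} \<union> y ` {1..n})"

definition parent_edges :: "(nat \<Rightarrow> nat) \<Rightarrow> (nat \<Rightarrow> nat) \<Rightarrow> nat \<Rightarrow> (nat \<times> nat) set" where
  "parent_edges x y n = (\<Union>k\<in>{1..n}. {(k, x k), (k, y k)})"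

text \<open>Only edges leaving vertices up to \<open>w\<close> are used, so that this depends on the history up to
  \<open>w\<close> alone; as parents have smaller labels, nothing is lost.\<close>

definition approves :: "(nat \<Rightarrow> nat) \<Rightarrow> (nat \<Rightarrow> nat) \<Rightarrow> nat \<Rightarrow> nat \<Rightarrow> bool" where
  "approves x y v w \<longleftrightarrow> (w, v) \<in> (parent_edges x y w)\<^sup>*"

text \<open>After time \<open>m\<close> a stretch of \<open>l\<close> approving vertices is
  required, because during that stretch vertices that are already referenced may still look like
  tips. Asking for \<open>m + l \<le> n\<close> makes the property decidable from the history up to
  \<open>n\<close> and monotone in \<open>n\<close>.\<close>

definition settled :: "(nat \<Rightarrow> nat) \<Rightarrow> (nat \<Rightarrow> nat) \<Rightarrow> nat \<Rightarrow> nat \<Rightarrow> nat \<Rightarrow> bool" where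
  "settled x y v l n \<longleftrightarrow> (\<exists>m. m + l \<le> n \<and> (\<forall>p\<in>unreferenced x y m. approves x y v p)
     \<and> (\<forall>w\<in>{m<..m + l}. approves x y v w))"

definition unsettled_tips :: "(nat \<Rightarrow> nat) \<Rightarrow> (nat \<Rightarrow> nat) \<Rightarrow> nat \<Rightarrow> nat \<Rightarrow> nat set" where
  "unsettled_tips x y v n = {p \<in> unreferenced x y n. \<not> approves x y v p}"

text \<open>The first parent makes the new vertex approve \<open>v\<close>, so that it does not
  become unsettled itself; the second one removes an unsettled tip whenever one is visible. The
  clause \<open>x m < m\<close> lets approval pass from \<open>x m\<close> to \<open>m\<close> and
  keeps the predicate determined by the history up to \<open>m\<close>.\<close>

definition favourable_choice ::
  "(nat \<Rightarrow> nat) \<Rightarrow> (nat \<Rightarrow> nat) \<Rightarrow> (nat \<Rightarrow> nat) \<Rightarrow> (nat \<Rightarrow> nat) \<Rightarrow> nat \<Rightarrow> nat \<Rightarrow> bool"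
where
  "favourable_choice \<theta> \<epsilon> x y v m \<longleftrightarrow> x m < m \<and> approves x y v (x m) \<and>
     (visible_tips \<theta> x y m (\<epsilon> m) \<inter> unsettled_tips x y v (m - 1) \<noteq> {}
       \<longrightarrow> y m \<in> unsettled_tips x y v (m - 1))"

section \<open>Dependence on the history alone, and monotonicity\<close>

lemma unreferenced_cong:
  assumes "\<And>k. 1 \<le> k \<Longrightarrow> k \<le> n \<Longrightarrow> x k = x' k \<and> y k = y' k"
  shows "unreferenced x y n = unreferenced x' y' n"
  unfolding unreferenced_def using assms by (metis (no_types, lifting) atLeastAtMost_iff image_cong)

lemma approves_cong:
  assumes "\<And>k. 1 \<le> k \<Longrightarrow> k \<le> w \<Longrightarrow> x k = x' k \<and> y k = y' k"
  shows "approves x y v w = approves x' y' v w"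
proof -
  have "parent_edges x y w = parent_edges x' y' w"
    unfolding parent_edges_def by (intro SUP_cong refl) (use assms in auto)
  then show ?thesis by (simp add: approves_def)
qed

lemma unsettled_tips_cong:
  assumes "\<And>k. 1 \<le> k \<Longrightarrow> k \<le> n \<Longrightarrow> x k = x' k \<and> y k = y' k"
  shows "unsettled_tips x y v n = unsettled_tips x' y' v n"
proof -
  have "approves x y v p = approves x' y' v p" if "p \<le> n" for p
    using assms that by (intro approves_cong) auto
  moreover have "p \<le> n" if "p \<in> unreferenced x' y' n" for p
    using that by (simp add: unreferenced_def)
  ultimately show ?thesis
    unfolding unsettled_tips_def using unreferenced_cong[of n x x' y y', OF assms] by auto
qed

lemma settled_cong:
  assumes "\<And>k. 1 \<le> k \<Longrightarrow> k \<le> n \<Longrightarrow> x k = x' k \<and> y k = y' k"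
  shows "settled x y v l n = settled x' y' v l n"
proof -
  have a: "approves x y v p = approves x' y' v p" if "p \<le> n" for p
    using assms that by (intro approves_cong) auto
  have u: "unreferenced x y m = unreferenced x' y' m" if "m \<le> n" for m
    using assms that by (intro unreferenced_cong) auto
  have "(\<forall>p\<in>unreferenced x y m. approves x y v p) \<longleftrightarrow> (\<forall>p\<in>unreferenced x' y' m. approves x' y' v p)"
    "(\<forall>w\<in>{m<..m + l}. approves x y v w) \<longleftrightarrow> (\<forall>w\<in>{m<..m + l}. approves x' y' v w)"
    if "m + l \<le> n" for m
    using u[of m] a that by (auto simp: unreferenced_def)
  then show ?thesis unfolding settled_def by blast
qed

lemma finite_unreferenced [simp]: "finite (unreferenced x y n)"
  by (simp add: unreferenced_def)

lemma card_unreferenced_le: "card (unreferenced x y n) \<le> n + 1"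
  using card_mono[of "{..n}" "unreferenced x y n"] by (auto simp: unreferenced_def)

lemma settled_mono: "settled x y v l n \<Longrightarrow> n \<le> n' \<Longrightarrow> settled x y v l n'"
  unfolding settled_def by (meson order_trans)

lemma parent_edges_mono: "n \<le> n' \<Longrightarrow> parent_edges x y n \<subseteq> parent_edges x y n'"
  unfolding parent_edges_def by (intro UN_mono) auto

lemma approves_parent:
  assumes "1 \<le> w" "p \<in> {x w, y w}" "p < w" "approves x y v p"
  shows "approves x y v w"
proof -
  have "(w, p) \<in> parent_edges x y w" using assms unfolding parent_edges_def by auto
  moreover have "(p, v) \<in> (parent_edges x y w)\<^sup>*"
    using assms(4) rtrancl_mono[OF parent_edges_mono[of p w x y]] assms(3) unfolding approves_def by auto
  ultimately show ?thesis unfolding approves_def by (rule converse_rtrancl_into_rtrancl)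
qed

text \<open>The deterministic constraints that hold almost surely, with \<open>a\<close> and
  \<open>b\<close> bounding durations and lags. They concern vertices up to \<open>n\<close> only,
  so that they can be checked on a finite history.\<close>

locale tangle_prefix =
  fixes \<theta> \<epsilon> x y :: "nat \<Rightarrow> nat" and a b n :: nat
  assumes duration_le: "\<And>m. 1 \<le> m \<Longrightarrow> m \<le> n \<Longrightarrow> \<theta> m \<le> a"
    and lag_le: "\<And>m. 1 \<le> m \<Longrightarrow> m \<le> n \<Longrightarrow> \<epsilon> m \<le> b"
    and lag_pos: "\<And>m. 1 \<le> m \<Longrightarrow> m \<le> n \<Longrightarrow> 1 \<le> \<epsilon> m"
    and parents: "\<And>m. 1 \<le> m \<Longrightarrow> m \<le> n \<Longrightarrow>
      x m \<in> visible_tips \<theta> x y m (\<epsilon> m) \<and> y m \<in> visible_tips \<theta> x y m (\<epsilon> m)"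
begin

section \<open>Visible tips compared with unreferenced vertices\<close>

lemma parent_less:
  assumes "1 \<le> m" "m \<le> n"
  shows "x m < m" "y m < m"
  using parents[OF assms] lag_pos[OF assms] assms unfolding visible_tips_def mem_tips_tangle_nat_iff
  by auto

lemma visible_tips_less: "1 \<le> m \<Longrightarrow> 1 \<le> j \<Longrightarrow> p \<in> visible_tips \<theta> x y m j \<Longrightarrow> p < m"
  unfolding visible_tips_def mem_tips_tangle_nat_iff by auto

text \<open>Among the visible vertices that approve \<open>v\<close>, the one with the largest label
  is a tip: a visible vertex referring to it would have a larger label and approve \<open>v\<close>
  too.\<close>

lemma approving_tip_exists:
  assumes "t \<le> Suc n" "v = 0 \<or> v + \<theta> v < t"
  shows "\<exists>g\<in>tips (tangle_nat \<theta> x y t). approves x y v g"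
proof -
  let ?G = "{g \<in> pverts (tangle_nat \<theta> x y t). approves x y v g}"
  have fin: "finite ?G"
    by (rule finite_subset[of _ "{..t}"]) (auto simp: tangle_nat_closed_form)
  have "v \<in> ?G" using assms(2) by (cases "v = 0") (auto simp: tangle_nat_closed_form approves_def)
  then have M: "Max ?G \<in> ?G" using fin by (intro Max_in) auto
  have "Max ?G \<in> tips (tangle_nat \<theta> x y t)"
  proof (rule ccontr)
    assume "Max ?G \<notin> tips (tangle_nat \<theta> x y t)"
    then obtain i where i: "(i, Max ?G) \<in> parcs (tangle_nat \<theta> x y t)"
      using M unfolding tips_def by auto
    then have i': "1 \<le> i" "i + \<theta> i < t" "Max ?G \<in> {x i, y i}"
      by (auto simp: tangle_nat_closed_form)
    then have less: "Max ?G < i" using parent_less[of i] assms(1) by auto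
    have "approves x y v i" using i' less M by (intro approves_parent[of i "Max ?G"]) auto
    then have "i \<in> ?G" using i' by (auto simp: tangle_nat_closed_form)
    then show False using less Max_ge[OF fin, of i] by simp
  qed
  then show ?thesis using M by blast
qed

text \<open>Such a vertex finished its proof of work at most \<open>a\<close> steps after arriving,
  and the graph that is seen is at most \<open>b\<close> steps old.\<close>

lemma visible_unreferenced:
  assumes "m - 1 \<le> n" "1 \<le> m" "1 \<le> j" "j \<le> b" "p \<in> unreferenced x y (m - 1)" "p + a + b < m"
  shows "p \<in> visible_tips \<theta> x y m j"
proof -
  have "p + \<theta> p < m - j" if "p \<noteq> 0"
    using duration_le[of p] that assms by linarith
  then have "p = 0 \<or> p + \<theta> p < m - j" by blast
  moreover have "x k \<noteq> p \<and> y k \<noteq> p" if "1 \<le> k" "k + \<theta> k < m - j" for k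
    using assms(5) that unfolding unreferenced_def by auto
  ultimately show ?thesis unfolding visible_tips_def mem_tips_tangle_nat_iff by blast
qed

text \<open>A reference made by \<open>k\<close> is visible to every vertex later than
  \<open>k + a + b\<close>, so a referenced vertex that still looks like a tip owes its references
  to recent vertices.\<close>

lemma visible_tips_recently_referenced:
  assumes "m - 1 \<le> n" "1 \<le> m" "1 \<le> j" "j \<le> b" "p \<in> visible_tips \<theta> x y m j"
    "p \<notin> unreferenced x y (m - 1)"
  shows "\<exists>k. 1 \<le> k \<and> k < m \<and> m \<le> k + a + b \<and> p \<in> {x k, y k}"
proof -
  have "p < m" using visible_tips_less assms by blast
  then obtain k where k: "1 \<le> k" "k \<le> m - 1" "p \<in> {x k, y k}"
    using assms(6) unfolding unreferenced_def by auto
  then have "\<not> k + \<theta> k < m - j"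
    using assms(5) unfolding visible_tips_def mem_tips_tangle_nat_iff by auto
  moreover have "\<theta> k \<le> a" using k assms by (intro duration_le) auto
  ultimately show ?thesis using k assms by (intro exI[of _ k]) auto
qed

text \<open>Each of the last \<open>a + b\<close> vertices contributes at most its two
  parents.\<close>

lemma card_recently_referenced:
  assumes "m - 1 \<le> n" "1 \<le> m" "1 \<le> j" "j \<le> b"
  shows "card (visible_tips \<theta> x y m j - unreferenced x y (m - 1)) \<le> 2 * (a + b)"
proof -
  let ?K = "{m - (a + b)..<m}"
  have sub: "visible_tips \<theta> x y m j - unreferenced x y (m - 1) \<subseteq> x ` ?K \<union> y ` ?K"
  proof
    fix p assume "p \<in> visible_tips \<theta> x y m j - unreferenced x y (m - 1)"
    then obtain k where "1 \<le> k" "k < m" "m \<le> k + a + b" "p \<in> {x k, y k}"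
      using visible_tips_recently_referenced[OF assms, of p] by blast
    then have "k \<in> ?K" "p \<in> {x k, y k}" by auto
    then show "p \<in> x ` ?K \<union> y ` ?K" by blast
  qed
  have "card (visible_tips \<theta> x y m j - unreferenced x y (m - 1)) \<le> card (x ` ?K \<union> y ` ?K)"
    by (rule card_mono[OF _ sub]) simp
  also have "\<dots> \<le> card ?K + card ?K"
    by (rule order_trans[OF card_Un_le]) (intro add_mono card_image_le; simp)
  also have "\<dots> \<le> 2 * (a + b)" by simp
  finally show ?thesis .
qed

lemma card_visible_tips_le:
  assumes "m - 1 \<le> n" "1 \<le> m" "1 \<le> j" "j \<le> b"
  shows "card (visible_tips \<theta> x y m j) \<le> card (unreferenced x y (m - 1)) + 2 * (a + b)"
proof -
  let ?L = "visible_tips \<theta> x y m j" and ?U = "unreferenced x y (m - 1)"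
  have "card ?L \<le> card (?U \<union> (?L - ?U))"
    by (rule card_mono) (auto simp: visible_tips_def finite_tips_tangle_nat)
  also have "\<dots> \<le> card ?U + card (?L - ?U)" by (rule card_Un_le)
  finally show ?thesis using card_recently_referenced[OF assms] by linarith
qed

text \<open>An unreferenced vertex can only be invisible if it is one of the last
  \<open>a + b\<close> arrivals.\<close>

lemma card_visible_tips_ge:
  assumes "m - 1 \<le> n" "1 \<le> m" "1 \<le> j" "j \<le> b"
  shows "card (unreferenced x y (m - 1)) \<le> card (visible_tips \<theta> x y m j) + (a + b)"
proof -
  let ?L = "visible_tips \<theta> x y m j" and ?U = "unreferenced x y (m - 1)"
  have "?U \<subseteq> ?L \<union> {m - (a + b)..<m}"
  proof
    fix p assume p: "p \<in> ?U"
    then have "p \<le> m - 1" by (simp add: unreferenced_def)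
    then show "p \<in> ?L \<union> {m - (a + b)..<m}"
      using visible_unreferenced[OF assms p] assms(2) by (cases "p + a + b < m") auto
  qed
  then have "card ?U \<le> card (?L \<union> {m - (a + b)..<m})"
    by (intro card_mono) (auto simp: visible_tips_def finite_tips_tangle_nat)
  also have "\<dots> \<le> card ?L + card {m - (a + b)..<m}" by (rule card_Un_le)
  finally show ?thesis by simp
qed

lemma unreferenced_step:
  assumes "1 \<le> m" "m \<le> n"
  shows "unreferenced x y m = insert m (unreferenced x y (m - 1) - {x m, y m})"
proof -
  have "{1..m} = insert m {1..m - 1}" "{..m} = insert m {..m - 1}" using assms by auto
  \<comment> \<open>Parents have smaller labels, so \<open>m\<close> itself cannot have been picked
    by any vertex up to \<open>m\<close>.\<close>
  moreover have "m \<notin> x ` {1..m - 1}" "m \<notin> y ` {1..m - 1}" "x m \<noteq> m" "y m \<noteq> m"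
    using parent_less[of m] assms
    by (auto dest!: parent_less[THEN less_imp_neq] intro!: notI)
       (metis One_nat_def diff_le_self le_trans not_le parent_less diff_Suc_less less_le_trans)+
  ultimately show ?thesis unfolding unreferenced_def by auto
qed

text \<open>The new vertex adds one, and two distinct unreferenced parents would remove two. The
  three error terms are the ways to remove fewer, kept separate so that their probabilities can be
  bounded one by one; they may overcount, hence an inequality.\<close>

lemma card_unreferenced_step:
  assumes "1 \<le> m" "m \<le> n"
  shows "card (unreferenced x y m) + 1 \<le> card (unreferenced x y (m - 1))
    + of_bool (x m \<notin> unreferenced x y (m - 1)) + of_bool (y m \<notin> unreferenced x y (m - 1))
    + of_bool (x m = y m)"
proof -
  let ?U = "unreferenced x y (m - 1)"
  have "card (unreferenced x y m) = card (?U - {x m, y m}) + 1"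
    unfolding unreferenced_step[OF assms]
    by (subst card_insert_disjoint) (use assms in \<open>auto simp: unreferenced_def\<close>)
  moreover have "card (?U - {x m, y m}) = card ?U - card (?U \<inter> {x m, y m})"
    by (metis card_Diff_subset_Int finite_Int finite_unreferenced)
  moreover have "card (?U \<inter> {x m, y m}) \<le> card ?U" by (intro card_mono) auto
  moreover have "2 \<le> card (?U \<inter> {x m, y m}) + (of_bool (x m \<notin> ?U) + of_bool (y m \<notin> ?U)
    + of_bool (x m = y m))"
  proof -
    consider "x m \<in> ?U" "y m \<in> ?U" "x m = y m" | "x m \<in> ?U" "y m \<in> ?U" "x m \<noteq> y m"
      | "x m \<in> ?U" "y m \<notin> ?U" | "x m \<notin> ?U" "y m \<in> ?U" | "x m \<notin> ?U" "y m \<notin> ?U" by blast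
    then show ?thesis
      by cases (simp_all add: Int_insert_right)
  qed
  ultimately show ?thesis by linarith
qed

lemma card_unreferenced_Suc_le:
  assumes "m < n"
  shows "card (unreferenced x y (Suc m)) \<le> card (unreferenced x y m) + 1"
proof -
  have "unreferenced x y (Suc m) \<subseteq> insert (Suc m) (unreferenced x y m)"
    using unreferenced_step[of "Suc m"] assms by auto
  from card_mono[OF _ this] show ?thesis
    by (simp add: card_insert_if split: if_splits)
qed

text \<open>Once every unreferenced vertex at time \<open>m\<close> approves \<open>v\<close>, the other vertices up to \<open>m\<close> can only
  be picked as parents until the references to them become visible, that is, within \<open>a + b\<close> steps.\<close>

lemma settled_imp_approves:
  assumes "\<forall>p\<in>unreferenced x y m. approves x y v p" "\<forall>w\<in>{m<..m + (a + b)}. approves x y v w"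
    "m < w" "w \<le> n"
  shows "approves x y v w"
  using assms(3,4)
proof (induction w rule: less_induct)
  case (less w)
  show ?case
  proof (cases "w \<le> m + (a + b)")
    case True
    then show ?thesis using assms(2) less.prems by auto
  next
    case False
    have w: "1 \<le> w" using less.prems by simp
    have xw: "x w < w" using parent_less[of w] less.prems w by simp
    have "approves x y v (x w)"
    proof (cases "m < x w")
      case True
      then show ?thesis using less.IH[of "x w"] xw less.prems by simp
    next
      case xm: False
      have "x w \<in> unreferenced x y m"
      proof (rule ccontr)
        assume "x w \<notin> unreferenced x y m"
        then obtain k where k: "1 \<le> k" "k \<le> m" "x w \<in> {x k, y k}"
          using xm unfolding unreferenced_def by auto
        have "\<theta> k \<le> a" "\<epsilon> w \<le> b" using k w less.prems by (auto intro: duration_le lag_le)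
        then have "k + \<theta> k < w - \<epsilon> w" using False k by linarith
        then show False
          using k parents[of w] w less.prems unfolding visible_tips_def mem_tips_tangle_nat_iff by auto
      qed
      then show ?thesis using assms(1) by blast
    qed
    then show ?thesis using approves_parent[of w "x w"] w xw by simp
  qed
qed

text \<open>There are three phases. During the first \<open>a + b\<close> steps all unsettled
  vertices up to \<open>m\<close> become visible, during the next \<open>c\<close> steps they are
  removed one at a time, and the last \<open>a + b\<close> steps supply the stretch that
  \<open>settled\<close> asks for.\<close>

lemma favourable_choices_settle:
  assumes fav: "\<And>i. i < 2 * (a + b) + c \<Longrightarrow> favourable_choice \<theta> \<epsilon> x y v (Suc (m + i))"
    and c: "card (unreferenced x y m) \<le> c" and n: "m + (2 * (a + b) + c) \<le> n"
  shows "settled x y v (a + b) (m + (2 * (a + b) + c))"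
proof -
  let ?l = "a + b" and ?B = "unsettled_tips x y v"
  have app: "approves x y v w" if "m < w" "w \<le> m + (2 * ?l + c)" for w
  proof -
    have "favourable_choice \<theta> \<epsilon> x y v w" using fav[of "w - Suc m"] that by simp
    then have "approves x y v (x w)" by (simp add: favourable_choice_def)
    then show ?thesis using approves_parent[of w "x w"] parent_less[of w] that n by simp
  qed
  have step: "?B (Suc w) \<subseteq> ?B w - {y (Suc w)}" if "m \<le> w" "w < m + (2 * ?l + c)" for w
    using unreferenced_step[of "Suc w"] that n app[of "Suc w"] unfolding unsettled_tips_def by auto
  have fin: "finite (?B w)" for w unfolding unsettled_tips_def by simp
  \<comment> \<open>All vertices after \<open>m\<close> approve \<open>v\<close>, so no new
    unsettled tips arise.\<close>
  have old: "p \<le> m" if "p \<in> ?B w" "w \<le> m + (2 * ?l + c)" for p w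
    using app[of p] that unfolding unsettled_tips_def unreferenced_def by (cases "p \<le> m") auto
  have "card (?B (m + i)) \<le> c" if "i \<le> ?l" for i
    using that
  proof (induction i)
    case 0
    have "card (?B m) \<le> card (unreferenced x y m)"
      unfolding unsettled_tips_def by (intro card_mono) auto
    then show ?case using c by simp
  next
    case (Suc i)
    have "?B (Suc (m + i)) \<subseteq> ?B (m + i)" using step[of "m + i"] Suc.prems by auto
    then have "card (?B (Suc (m + i))) \<le> card (?B (m + i))" by (intro card_mono fin)
    then show ?case using Suc by simp
  qed
  then have start: "card (?B (m + ?l)) \<le> c" by simp
  \<comment> \<open>An unsettled tip is by now at least \<open>a + b\<close> steps old, hence
    visible, and the favourable choice must hit such a tip. Truncated subtraction covers the case
    that none is left.\<close>
  have "card (?B (m + ?l + i)) \<le> c - i" if "i \<le> c" for i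
    using that
  proof (induction i)
    case 0
    show ?case using start by simp
  next
    case (Suc i)
    let ?w = "m + ?l + i"
    show ?case
    proof (cases "?B ?w = {}")
      case True
      then have "?B (Suc ?w) = {}" using step[of ?w] Suc.prems by auto
      then show ?thesis by simp
    next
      case False
      then obtain p where p: "p \<in> ?B ?w" by blast
      then have "p \<le> m" using old[of p ?w] Suc.prems by simp
      then have "p \<in> visible_tips \<theta> x y (Suc ?w) (\<epsilon> (Suc ?w))"
        using p Suc.prems n lag_pos[of "Suc ?w"] lag_le[of "Suc ?w"]
        by (intro visible_unreferenced) (auto simp: unsettled_tips_def)
      then have "y (Suc ?w) \<in> ?B ?w"
        using fav[of "?l + i"] p Suc.prems by (auto simp: favourable_choice_def add.assoc)
      then have "card (?B ?w - {y (Suc ?w)}) < card (?B ?w)" by (intro card_Diff1_less fin)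
      moreover have "card (?B (Suc ?w)) \<le> card (?B ?w - {y (Suc ?w)})"
        using step[of ?w] Suc.prems fin by (intro card_mono) auto
      ultimately show ?thesis using Suc by simp
    qed
  qed
  from this[of c] have "?B (m + ?l + c) = {}" using fin by simp
  then have "\<forall>p\<in>unreferenced x y (m + ?l + c). approves x y v p"
    unfolding unsettled_tips_def by blast
  moreover have "\<forall>w\<in>{m + ?l + c<..m + ?l + c + ?l}. approves x y v w" using app by auto
  ultimately show ?thesis unfolding settled_def by (intro exI[of _ "m + ?l + c"]) auto
qed

end

section \<open>The infinite graph\<close>

text \<open>The deterministic half of the theorem: what remains for probability is that the two
  assumptions hold almost surely.\<close>

lemma tangle_limit:
  fixes \<theta> \<epsilon> x y :: "nat \<Rightarrow> nat"
  assumes prefix: "\<And>n. tangle_prefix \<theta> \<epsilon> x y a b n"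
    and settled: "\<And>v. \<exists>n. settled x y v (a + b) n"
  defines "G \<equiv> \<lparr>pverts = (\<Union>i\<in>{1..}. pverts (tangle_nat \<theta> x y i)),
    parcs = (\<Union>i\<in>{1..}. parcs (tangle_nat \<theta> x y i))\<rparr>"
  shows "converges_to (tangle_nat \<theta> x y) G" "\<forall>v\<in>pverts G. confirmed G v"
proof -
  have less: "x k < k" "y k < k" if "1 \<le> k" for k
    using tangle_prefix.parent_less[OF prefix[of k], of k] that by auto
  have ready: "\<exists>i\<ge>1. k + \<theta> k < i" for k :: nat by (intro exI[of _ "Suc (k + \<theta> k)"]) simp
  have pG: "pverts G = UNIV"
    using ready unfolding G_def by (force simp: tangle_nat_closed_form)
  have aG: "parcs G = (\<Union>k\<in>{1..}. {(k, x k), (k, y k)})"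
    using ready unfolding G_def by (fastforce simp: tangle_nat_closed_form)
  have in_degree: "finite {k. 1 \<le> k \<and> (x k = v \<or> y k = v)}" (is "finite ?K") for v
  proof (cases "?K = {}")
    case False
    then obtain k where k: "k \<in> ?K" by blast
    \<comment> \<open>The reference made by \<open>k\<close> is visible to every vertex after
      \<open>k + a + b\<close>, and from then on \<open>v\<close> is no longer a tip.\<close>
    have "?K \<subseteq> {..k + a + b}"
    proof
      fix m assume m: "m \<in> ?K"
      then have "v \<in> visible_tips \<theta> x y m (\<epsilon> m)" "\<epsilon> m \<le> b"
        using tangle_prefix.parents[OF prefix[of m], of m] tangle_prefix.lag_le[OF prefix[of m], of m]
        by auto
      moreover have "\<theta> k \<le> a" using tangle_prefix.duration_le[OF prefix[of k], of k] k by simp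
      ultimately show "m \<in> {..k + a + b}"
        using k unfolding visible_tips_def mem_tips_tangle_nat_iff by fastforce
    qed
    then show ?thesis by (rule finite_subset) simp
  qed (simp only: finite.emptyI)
  have G: "G \<in> rooted_dags"
  proof (rule rooted_dagsI)
    fix v show "finite {u. (u, v) \<in> parcs G}"
      by (rule finite_subset[OF _ in_degree[of v]]) (auto simp: aG)
  next
    fix u :: nat assume "u \<noteq> 0"
    then show "\<exists>w. (u, w) \<in> parcs G" unfolding aG by (intro exI[of _ "x u"]) auto
  qed (use less in \<open>auto simp: pG aG\<close>)
  have dags: "tangle_nat \<theta> x y i \<in> rooted_dags" for i
  proof (rule rooted_dagsI)
    show "0 \<in> pverts (tangle_nat \<theta> x y i)" by (simp add: tangle_nat_closed_form)
  next
    fix u w assume "(u, w) \<in> parcs (tangle_nat \<theta> x y i)"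
    then have u: "1 \<le> u" "u + \<theta> u < i" "w \<in> {x u, y u}" by (auto simp: tangle_nat_closed_form)
    \<comment> \<open>A parent was a tip of an earlier graph, so it is present whenever the vertex
      choosing it is.\<close>
    then have "w \<in> tips (tangle_nat \<theta> x y (u - \<epsilon> u))"
      using tangle_prefix.parents[OF prefix[of u], of u] by (auto simp: visible_tips_def)
    then have "w = 0 \<or> w + \<theta> w < i" using u by (auto simp: mem_tips_tangle_nat_iff)
    then show "u \<in> pverts (tangle_nat \<theta> x y i) \<and> w \<in> pverts (tangle_nat \<theta> x y i) \<and> w < u"
      using u less[of u] by (cases "w = 0") (auto simp: tangle_nat_closed_form)
  next
    fix u assume "u \<in> pverts (tangle_nat \<theta> x y i)" "u \<noteq> 0"
    then have "u \<in> {k. 1 \<le> k \<and> k + \<theta> k < i}" by (simp add: tangle_nat_closed_form)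
    then show "\<exists>w. (u, w) \<in> parcs (tangle_nat \<theta> x y i)"
      unfolding tangle_nat_closed_form by (intro exI[of _ "x u"] UN_I[of u]) simp_all
  next
    fix v show "finite {u. (u, v) \<in> parcs (tangle_nat \<theta> x y i)}"
      by (rule finite_subset[of _ "{..i}"]) (auto simp: tangle_nat_closed_form)
  qed
  show "converges_to (tangle_nat \<theta> x y) G"
  proof (rule converges_to_increasing_union[OF dags G])
    show "parcs G = (\<Union>i. parcs (tangle_nat \<theta> x y i))"
      unfolding aG using ready by (fastforce simp: tangle_nat_closed_form)
  next
    fix i j :: nat assume "i \<le> j"
    then show "parcs (tangle_nat \<theta> x y i) \<subseteq> parcs (tangle_nat \<theta> x y j)"
      by (auto simp: tangle_nat_closed_form)
  qed
  have edges: "parent_edges x y w \<subseteq> parcs G" for w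
    unfolding parent_edges_def aG by (intro UN_mono) auto
  show "\<forall>v\<in>pverts G. confirmed G v"
  proof
    fix v
    obtain m where m: "\<forall>p\<in>unreferenced x y m. approves x y v p"
        "\<forall>w\<in>{m<..m + (a + b)}. approves x y v w"
      using settled[of v] unfolding settled_def by blast
    have "directed_path G w v" if "m < w" for w
    proof (rule rtrancl_imp_directed_path)
      have "approves x y v w"
        using tangle_prefix.settled_imp_approves[OF prefix[of w] m that] by simp
      then show "(w, v) \<in> (parcs G)\<^sup>*"
        unfolding approves_def using rtrancl_mono[OF edges] by blast
    qed (use G in \<open>auto simp: pG rooted_dags_def\<close>)
    then have "{w \<in> pverts G. v < w \<and> \<not> directed_path G w v} \<subseteq> {..m}"
      using not_le by auto
    then show "confirmed G v" unfolding confirmed_def by (rule finite_subset) simp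
  qed
qed

section \<open>The law of one step\<close>

context tangle_model
begin

definition hist :: "nat \<Rightarrow> 'a \<Rightarrow> (nat \<times> nat \<times> nat \<times> nat) list" where
  "hist n \<omega> = map (\<lambda>m. (\<Theta> m \<omega>, \<epsilon> m \<omega>, X m \<omega>, Y m \<omega>)) [1..<Suc n]"

text \<open>The cylinders are the atoms of the history; conditioning on the history amounts to
  working on one of them.\<close>

definition cylinder :: "nat \<Rightarrow> 'a \<Rightarrow> 'a set" where
  "cylinder n \<omega>\<^sub>0 = {\<omega> \<in> space P. hist n \<omega> = hist n \<omega>\<^sub>0}"

text \<open>Since \<open>hist n\<close> takes countably many values, being a function of it already
  implies measurability, see \<open>adapted_measurable\<close>.\<close>

definition adapted :: "nat \<Rightarrow> ('a \<Rightarrow> 'b) \<Rightarrow> bool" where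
  "adapted n f \<longleftrightarrow> (\<forall>\<omega> \<omega>'. hist n \<omega> = hist n \<omega>' \<longrightarrow> f \<omega> = f \<omega>')"

abbreviation seen :: "nat \<Rightarrow> nat \<Rightarrow> 'a \<Rightarrow> nat set" where
  "seen n j \<omega> \<equiv> visible_tips (\<lambda>m. \<Theta> m \<omega>) (\<lambda>m. X m \<omega>) (\<lambda>m. Y m \<omega>) n j"

abbreviation free :: "nat \<Rightarrow> 'a \<Rightarrow> nat set" where
  "free n \<omega> \<equiv> unreferenced (\<lambda>m. X m \<omega>) (\<lambda>m. Y m \<omega>) n"

abbreviation prefix :: "nat \<Rightarrow> 'a \<Rightarrow> bool" where
  "prefix n \<omega> \<equiv> tangle_prefix (\<lambda>m. \<Theta> m \<omega>) (\<lambda>m. \<epsilon> m \<omega>) (\<lambda>m. X m \<omega>) (\<lambda>m. Y m \<omega>) (h M) (Max I) n"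

abbreviation favourable :: "nat \<Rightarrow> nat \<Rightarrow> 'a \<Rightarrow> bool" where
  "favourable v n \<omega> \<equiv>
    favourable_choice (\<lambda>m. \<Theta> m \<omega>) (\<lambda>m. \<epsilon> m \<omega>) (\<lambda>m. X m \<omega>) (\<lambda>m. Y m \<omega>) v n"

abbreviation open_at :: "nat \<Rightarrow> nat \<Rightarrow> 'a \<Rightarrow> bool" where
  "open_at v n \<omega> \<equiv> \<not> settled (\<lambda>m. X m \<omega>) (\<lambda>m. Y m \<omega>) v (h M + Max I) n"

section \<open>Adaptedness and measurability\<close>

lemma hist_eq_iff:
  "hist n \<omega> = hist n \<omega>' \<longleftrightarrow> (\<forall>m. 1 \<le> m \<longrightarrow> m \<le> n \<longrightarrow>
    \<Theta> m \<omega> = \<Theta> m \<omega>' \<and> \<epsilon> m \<omega> = \<epsilon> m \<omega>' \<and> X m \<omega> = X m \<omega>' \<and> Y m \<omega> = Y m \<omega>')"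
  unfolding hist_def map_eq_conv by (auto simp: less_Suc_eq_le)

lemma hist_mono: "hist n \<omega> = hist n \<omega>' \<Longrightarrow> m \<le> n \<Longrightarrow> hist m \<omega> = hist m \<omega>'"
  unfolding hist_eq_iff by auto

lemma adaptedD: "adapted n f \<Longrightarrow> hist n \<omega> = hist n \<omega>' \<Longrightarrow> f \<omega> = f \<omega>'"
  unfolding adapted_def by blast

lemma adapted_cylinder:
  "adapted n f \<Longrightarrow> \<omega> \<in> cylinder n \<omega>\<^sub>0 \<Longrightarrow> f \<omega> = f \<omega>\<^sub>0"
  unfolding cylinder_def by (blast dest: adaptedD)

lemma adapted_mono: "adapted m f \<Longrightarrow> m \<le> n \<Longrightarrow> adapted n f"
  unfolding adapted_def using hist_mono by blast

lemma adapted_seen: "n \<le> Suc m \<Longrightarrow> adapted m (seen n j)"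
  unfolding adapted_def hist_eq_iff by (intro allI impI visible_tips_cong) auto

lemma adapted_free: "adapted n (free n)"
  unfolding adapted_def hist_eq_iff by (intro allI impI unreferenced_cong) auto

lemma adapted_open_at: "adapted n (open_at v n)"
  unfolding adapted_def hist_eq_iff
  by (intro allI impI arg_cong[where f = Not] settled_cong) auto

lemma adapted_prefix: "adapted n (prefix n)"
  unfolding adapted_def
proof (intro allI impI)
  fix \<omega> \<omega>' assume eq: "hist n \<omega> = hist n \<omega>'"
  have "seen m j \<omega> = seen m j \<omega>'" if "m \<le> n" for m j
    using adaptedD[OF adapted_seen eq] that by simp
  then show "prefix n \<omega> = prefix n \<omega>'"
    using eq unfolding tangle_prefix_def hist_eq_iff by (auto simp: le_Suc_eq)
qed

lemma adapted_favourable: "adapted (Suc n) (favourable v (Suc n))"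
  unfolding adapted_def
proof (intro allI impI)
  fix \<omega> \<omega>' assume eq: "hist (Suc n) \<omega> = hist (Suc n) \<omega>'"
  have 1: "seen (Suc n) j \<omega> = seen (Suc n) j \<omega>'" for j
    using adaptedD[OF adapted_seen eq] by simp
  have 2: "unsettled_tips (\<lambda>m. X m \<omega>) (\<lambda>m. Y m \<omega>) v n = unsettled_tips (\<lambda>m. X m \<omega>') (\<lambda>m. Y m \<omega>') v n"
    using eq unfolding hist_eq_iff by (intro unsettled_tips_cong) auto
  have 4: "approves (\<lambda>m. X m \<omega>) (\<lambda>m. Y m \<omega>) v w = approves (\<lambda>m. X m \<omega>') (\<lambda>m. Y m \<omega>') v w"
    if "w < Suc n" for w
    using eq that unfolding hist_eq_iff by (intro approves_cong) auto
  have 3: "\<Theta> (Suc n) \<omega> = \<Theta> (Suc n) \<omega>'" "\<epsilon> (Suc n) \<omega> = \<epsilon> (Suc n) \<omega>'"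
    "X (Suc n) \<omega> = X (Suc n) \<omega>'" "Y (Suc n) \<omega> = Y (Suc n) \<omega>'"
    using eq unfolding hist_eq_iff by auto
  show "favourable v (Suc n) \<omega> = favourable v (Suc n) \<omega>'"
    using 1 2 3 4 unfolding favourable_choice_def by auto
qed

lemma vimage_in_events:
  assumes "f \<in> P \<rightarrow>\<^sub>M count_space S"
  shows "f -` A \<inter> space P \<in> sets P"
proof -
  have "f -` A \<inter> space P = f -` (A \<inter> S) \<inter> space P"
    using measurable_space[OF assms] by auto
  then show ?thesis using measurable_sets[OF assms, of "A \<inter> S"] by simp
qed

lemma step_vimage_in_events:
  assumes "1 \<le> m" "Z \<in> {\<Theta> m, \<epsilon> m, X m, Y m}"
  shows "Z -` A \<inter> space P \<in> sets P"
  using assms vimage_in_events \<Theta>_measurable \<epsilon>_measurable X_measurable Y_measurable by blast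

lemma step_event [measurable]:
  assumes "1 \<le> n"
  shows "{\<omega> \<in> space P. Q (\<Theta> n \<omega>) (\<epsilon> n \<omega>) (X n \<omega>) (Y n \<omega>)} \<in> sets P"
proof -
  have m: "Z \<in> P \<rightarrow>\<^sub>M count_space UNIV" if "Z \<in> {\<Theta> n, \<epsilon> n, X n, Y n}" for Z
    using step_vimage_in_events[OF assms that] by (intro measurableI) auto
  have [measurable]: "\<Theta> n \<in> P \<rightarrow>\<^sub>M count_space UNIV" "\<epsilon> n \<in> P \<rightarrow>\<^sub>M count_space UNIV"
    "X n \<in> P \<rightarrow>\<^sub>M count_space UNIV" "Y n \<in> P \<rightarrow>\<^sub>M count_space UNIV"
    using m by auto
  show ?thesis by measurable
qed

lemma subalgebra_history: "subalgebra P (history P \<Theta> \<epsilon> X Y n)"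
  unfolding subalgebra_def history_def
proof
  let ?G = "\<Union>m\<in>{1..n}. \<Union>Z\<in>{\<Theta> m, \<epsilon> m, X m, Y m}. range (\<lambda>A. Z -` A \<inter> space P)"
  have G: "?G \<subseteq> sets P"
    by (intro UN_least image_subsetI step_vimage_in_events) auto
  then have "?G \<subseteq> Pow (space P)" using sets.space_closed by blast
  then show "space (sigma (space P) ?G) = space P" "sets (sigma (space P) ?G) \<subseteq> sets P"
    using sets.sigma_sets_subset[OF G] by (simp_all only: space_measure_of sets_measure_of)
qed

lemma cylinder_in_history: "cylinder n \<omega>\<^sub>0 \<in> sets (history P \<Theta> \<epsilon> X Y n)"
proof -
  let ?F = "history P \<Theta> \<epsilon> X Y n"
  have space: "space ?F = space P" using subalgebra_history by (simp add: subalgebra_def)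
  have top: "space P \<in> sets ?F" using sets.top[of ?F] unfolding space .
  have gen: "Z -` A \<inter> space P \<in> sets ?F" if "m \<in> {1..n}" "Z \<in> {\<Theta> m, \<epsilon> m, X m, Y m}" for m Z A
    unfolding history_def by (rule in_measure_of, blast, intro UN_I rangeI) (use that in auto)
  \<comment> \<open>The outer intersection with \<open>space P\<close> gives the right set for
    \<open>n = 0\<close>, where the inner intersection is over an empty index set.\<close>
  have "cylinder n \<omega>\<^sub>0 = space P \<inter> (\<Inter>m\<in>{1..n}. \<Inter>Z\<in>{\<Theta> m, \<epsilon> m, X m, Y m}.
      space P \<inter> (Z -` {Z \<omega>\<^sub>0} \<inter> space P))"
    unfolding cylinder_def hist_eq_iff by auto
  also have "\<dots> \<in> sets ?F"
  proof (cases "n = 0")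
    case True
    then show ?thesis using top by simp
  next
    case False
    have "space P \<inter> (Z -` A \<inter> space P) \<in> sets ?F" if "m \<in> {1..n}" "Z \<in> {\<Theta> m, \<epsilon> m, X m, Y m}" for m Z A
      using sets.Int[OF top gen[OF that]] .
    then have "(\<Inter>m\<in>{1..n}. \<Inter>Z\<in>{\<Theta> m, \<epsilon> m, X m, Y m}. space P \<inter> (Z -` {Z \<omega>\<^sub>0} \<inter> space P)) \<in> sets ?F"
      using False by (intro sets.finite_INT) auto
    then show ?thesis by (rule sets.Int[OF top])
  qed
  finally show ?thesis .
qed

lemma cylinder_in_events [measurable, simp]: "cylinder n \<omega>\<^sub>0 \<in> sets P"
  using cylinder_in_history[of n \<omega>\<^sub>0] subalgebra_history[of n] unfolding subalgebra_def by blast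

text \<open>Lists of tuples of natural numbers are countable, so checking singletons
  suffices.\<close>

lemma hist_measurable [measurable]: "hist n \<in> P \<rightarrow>\<^sub>M count_space UNIV"
proof -
  have "hist n -` {l} \<inter> space P \<in> sets P" for l
  proof (cases "\<exists>\<omega>\<^sub>0. hist n \<omega>\<^sub>0 = l")
    case True
    then obtain \<omega>\<^sub>0 where "hist n \<omega>\<^sub>0 = l" by blast
    then have "hist n -` {l} \<inter> space P = cylinder n \<omega>\<^sub>0" unfolding cylinder_def by auto
    then show ?thesis by simp
  next
    case False
    then have "hist n -` {l} \<inter> space P = {}" by auto
    then show ?thesis by simp
  qed
  then show ?thesis by (subst measurable_count_space_eq2_countable) auto
qed

lemma adapted_measurable:
  assumes "adapted n f"
  shows "f \<in> P \<rightarrow>\<^sub>M count_space UNIV"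
proof -
  have "f = (\<lambda>l. f (SOME \<omega>. hist n \<omega> = l)) \<circ> hist n"
  proof
    fix \<omega>
    have "hist n (SOME \<omega>'. hist n \<omega>' = hist n \<omega>) = hist n \<omega>" by (rule someI) simp
    then show "f \<omega> = ((\<lambda>l. f (SOME \<omega>. hist n \<omega> = l)) \<circ> hist n) \<omega>"
      using assms unfolding adapted_def by (metis comp_apply)
  qed
  moreover have "\<dots> \<in> P \<rightarrow>\<^sub>M count_space UNIV"
    by (rule measurable_comp[OF hist_measurable]) simp
  ultimately show ?thesis by simp
qed

lemma adapted_event: "adapted n E \<Longrightarrow> {\<omega> \<in> space P. E \<omega>} \<in> sets P"
  using measurable_sets[OF adapted_measurable, of n E "{True}"] by (simp add: vimage_def Int_def conj_commute)

section \<open>The law of one step on a cylinder\<close>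

lemma step_range: "\<omega> \<in> space P \<Longrightarrow> 1 \<le> n \<Longrightarrow> \<Theta> n \<omega> \<in> h ` {1..M} \<and> \<epsilon> n \<omega> \<in> I"
  using measurable_space[OF \<Theta>_measurable] measurable_space[OF \<epsilon>_measurable] by auto

lemma inj_on_h: "inj_on h {1..M}"
  using h_mono by (rule strict_mono_on_imp_inj_on)

text \<open>The visible tips are constant on the cylinder, so integrating the conditional
  expectation over it turns the law into a product formula.\<close>

lemma prob_cylinder_outcome:
  fixes \<omega>\<^sub>0 :: 'a
  assumes "1 \<le> n" "k \<in> {1..M}" "j \<in> I"
  defines "L \<equiv> seen n j \<omega>\<^sub>0"
  shows "prob (cylinder (n - 1) \<omega>\<^sub>0
      \<inter> {\<omega> \<in> space P. \<Theta> n \<omega> = h k \<and> \<epsilon> n \<omega> = j \<and> X n \<omega> = v \<and> Y n \<omega> = v'})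
    = prob (cylinder (n - 1) \<omega>\<^sub>0)
      * (p\<Theta> k * p\<epsilon> j / (real (card L))\<^sup>2 * indicator (L \<times> L) (v, v'))"
    (is "prob (?C \<inter> ?A) = prob ?C * ?c")
proof -
  let ?F = "history P \<Theta> \<epsilon> X Y (n - 1)"
  interpret F: finite_measure_subalgebra P ?F
    using subalgebra_history by unfold_locales
  have A: "?A \<in> sets P" using step_event[OF assms(1)] by simp
  have "AE \<omega> in P. indicator ?C \<omega> *\<^sub>R real_cond_exp P ?F (indicator ?A) \<omega> = indicator ?C \<omega> * ?c"
    using law[OF assms(1-3), of v v']
  proof eventually_elim
    case (elim \<omega>)
    show ?case
    proof (cases "\<omega> \<in> ?C")
      case True
      \<comment> \<open>Both sides cut off negative times at 0.\<close>
      have "nat (int n - int j) = n - j" by arith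
      then have "tips (random_tangle \<Theta> X Y (int n - int j) \<omega>) = seen n j \<omega>"
        by (simp add: random_tangle_def tangle_def visible_tips_def)
      also have "\<dots> = L"
        unfolding L_def by (rule adapted_cylinder[OF adapted_seen True]) simp
      finally show ?thesis using elim by (simp add: Let_def)
    qed simp
  qed
  then have "(LINT \<omega>:?C|P. real_cond_exp P ?F (indicator ?A) \<omega>) = (\<integral>\<omega>. indicator ?C \<omega> * ?c \<partial>P)"
    unfolding set_lebesgue_integral_def by (intro integral_cong_AE) auto
  also have "\<dots> = prob ?C * ?c" by simp
  finally have "(LINT \<omega>:?C|P. real_cond_exp P ?F (indicator ?A) \<omega>) = prob ?C * ?c" .
  moreover have "(LINT \<omega>:?C|P. indicator ?A \<omega>) = (LINT \<omega>:?C|P. real_cond_exp P ?F (indicator ?A) \<omega>)"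
    using A cylinder_in_history
    by (intro F.real_cond_exp_intA integrable_real_indicator) (auto simp: emeasure_eq_measure)
  moreover have "(LINT \<omega>:?C|P. indicator ?A \<omega>) = prob (?C \<inter> ?A)"
    unfolding set_lebesgue_integral_def using A by (simp flip: indicator_inter_arith)
  ultimately show ?thesis by simp
qed

text \<open>Summing over the durations removes their weights, which add up to 1, and leaves a
  uniformly chosen pair of visible tips.\<close>

lemma prob_cylinder_parents:
  fixes \<omega>\<^sub>0 :: 'a
  assumes "1 \<le> n" "j \<in> I"
  defines "L \<equiv> seen n j \<omega>\<^sub>0"
  shows "prob (cylinder (n - 1) \<omega>\<^sub>0 \<inter> {\<omega> \<in> space P. \<epsilon> n \<omega> = j \<and> (X n \<omega>, Y n \<omega>) \<in> S})
    = prob (cylinder (n - 1) \<omega>\<^sub>0) * p\<epsilon> j * (card (S \<inter> L \<times> L) / (real (card L))\<^sup>2)"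
proof -
  let ?C = "cylinder (n - 1) \<omega>\<^sub>0"
  define B where "B = (\<lambda>(k, v, v'). ?C
      \<inter> {\<omega> \<in> space P. \<Theta> n \<omega> = h k \<and> \<epsilon> n \<omega> = j \<and> X n \<omega> = v \<and> Y n \<omega> = v'})"
  have B: "B (k, s) \<in> sets P" for k s
    using step_event[OF assms(1)] unfolding B_def by (cases s) auto
  have prob_B: "prob (B (k, s))
      = prob ?C * (p\<Theta> k * p\<epsilon> j / (real (card L))\<^sup>2 * indicator (L \<times> L) s)" if "k \<in> {1..M}" for k s
    using prob_cylinder_outcome[OF assms(1) that assms(2)] unfolding B_def L_def by (cases s) simp
  have split: "?C \<inter> {\<omega> \<in> space P. \<epsilon> n \<omega> = j \<and> (X n \<omega>, Y n \<omega>) \<in> T} = (\<Union>q\<in>{1..M} \<times> T. B q)" for T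
    using step_range[OF _ assms(1)] unfolding B_def by fastforce
  have finL: "finite (L \<times> L)" unfolding L_def visible_tips_def by (simp add: finite_tips_tangle_nat)
  \<comment> \<open>There may be infinitely many pairs outside \<open>L \<times> L\<close>, but they
    are countable and each has probability 0. Discarding them leaves a finite sum.\<close>
  have null: "(\<Union>q\<in>{1..M} \<times> (S - L \<times> L). B q) \<in> null_sets P"
  proof (intro null_sets_UN')
    fix q assume "q \<in> {1..M} \<times> (S - L \<times> L)"
    then show "B q \<in> null_sets P"
      using prob_B[of "fst q" "snd q"] B[of "fst q" "snd q"]
      by (auto simp: null_sets_def emeasure_eq_measure indicator_def)
  qed (rule countableI_type)
  have "?C \<inter> {\<omega> \<in> space P. \<epsilon> n \<omega> = j \<and> (X n \<omega>, Y n \<omega>) \<in> S}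
      = (\<Union>q\<in>{1..M} \<times> (S \<inter> L \<times> L). B q) \<union> (\<Union>q\<in>{1..M} \<times> (S - L \<times> L). B q)"
    unfolding split by blast
  also have "prob \<dots> = prob (\<Union>q\<in>{1..M} \<times> (S \<inter> L \<times> L). B q)"
    using B finL by (intro measure_Un_null_set null) auto
  also have "\<dots> = (\<Sum>q\<in>{1..M} \<times> (S \<inter> L \<times> L). prob (B q))"
  proof (rule finite_measure_finite_Union)
    show "disjoint_family_on B ({1..M} \<times> (S \<inter> L \<times> L))"
      using inj_on_h unfolding disjoint_family_on_def B_def inj_on_def by fastforce
  qed (use finL B in auto)
  also have "\<dots> = (\<Sum>k\<in>{1..M}. \<Sum>s\<in>S \<inter> L \<times> L. prob ?C * (p\<Theta> k * p\<epsilon> j / (real (card L))\<^sup>2))"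
    unfolding sum.cartesian_product by (intro sum.cong refl) (auto simp: prob_B)
  also have "\<dots> = (\<Sum>k\<in>{1..M}. p\<Theta> k) * (prob ?C * p\<epsilon> j * (card (S \<inter> L \<times> L) / (real (card L))\<^sup>2))"
    unfolding sum_distrib_right by (intro sum.cong refl) (simp add: field_simps)
  finally show ?thesis using p\<Theta>_sum by simp
qed

text \<open>Only countably many cylinders exist, so their exceptional null sets can be
  joined.\<close>

lemma AE_cylinder:
  assumes "\<And>\<omega>\<^sub>0. \<omega>\<^sub>0 \<in> space P \<Longrightarrow> AE \<omega> in P. \<omega> \<in> cylinder n \<omega>\<^sub>0 \<longrightarrow> Q \<omega>"
  shows "AE \<omega> in P. Q \<omega>"
proof -
  have "AE \<omega> in P. hist n \<omega> = l \<longrightarrow> Q \<omega>" for l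
  proof (cases "l \<in> hist n ` space P")
    case True
    then obtain \<omega>\<^sub>0 where "\<omega>\<^sub>0 \<in> space P" "hist n \<omega>\<^sub>0 = l" by blast
    have "AE \<omega> in P. \<omega> \<in> cylinder n \<omega>\<^sub>0 \<longrightarrow> Q \<omega>" by (rule assms) fact
    with AE_space show ?thesis
      by eventually_elim (use \<open>hist n \<omega>\<^sub>0 = l\<close> in \<open>auto simp: cylinder_def\<close>)
  next
    case False
    show ?thesis using AE_space by eventually_elim (use False in auto)
  qed
  then have "AE \<omega> in P. \<forall>l. hist n \<omega> = l \<longrightarrow> Q \<omega>" unfolding AE_all_countable by blast
  then show ?thesis by simp
qed

lemma AE_parents_seen:
  assumes "1 \<le> n"
  shows "AE \<omega> in P. X n \<omega> \<in> seen n (\<epsilon> n \<omega>) \<omega> \<and> Y n \<omega> \<in> seen n (\<epsilon> n \<omega>) \<omega>"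
proof (rule AE_cylinder[of "n - 1"])
  fix \<omega>\<^sub>0
  let ?N = "\<lambda>j. cylinder (n - 1) \<omega>\<^sub>0
    \<inter> {\<omega> \<in> space P. \<epsilon> n \<omega> = j \<and> (X n \<omega>, Y n \<omega>) \<in> - (seen n j \<omega>\<^sub>0 \<times> seen n j \<omega>\<^sub>0)}"
  have "?N j \<in> null_sets P" if "j \<in> I" for j
    using prob_cylinder_parents[OF assms that, of \<omega>\<^sub>0 "- (seen n j \<omega>\<^sub>0 \<times> seen n j \<omega>\<^sub>0)"]
      step_event[OF assms, of "\<lambda>_ e x y. e = j \<and> (x, y) \<in> - (seen n j \<omega>\<^sub>0 \<times> seen n j \<omega>\<^sub>0)"]
    by (auto simp: null_sets_def emeasure_eq_measure)
  then have "(\<Union>j\<in>I. ?N j) \<in> null_sets P"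
    by (intro null_sets_UN' countable_finite finite_I)
  then show "AE \<omega> in P. \<omega> \<in> cylinder (n - 1) \<omega>\<^sub>0 \<longrightarrow>
      X n \<omega> \<in> seen n (\<epsilon> n \<omega>) \<omega> \<and> Y n \<omega> \<in> seen n (\<epsilon> n \<omega>) \<omega>"
  proof (rule AE_I')
    show "{\<omega> \<in> space P. \<not> (\<omega> \<in> cylinder (n - 1) \<omega>\<^sub>0 \<longrightarrow>
      X n \<omega> \<in> seen n (\<epsilon> n \<omega>) \<omega> \<and> Y n \<omega> \<in> seen n (\<epsilon> n \<omega>) \<omega>)} \<subseteq> (\<Union>j\<in>I. ?N j)"
    proof
      fix \<omega> assume "\<omega> \<in> {\<omega> \<in> space P. \<not> (\<omega> \<in> cylinder (n - 1) \<omega>\<^sub>0 \<longrightarrow>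
        X n \<omega> \<in> seen n (\<epsilon> n \<omega>) \<omega> \<and> Y n \<omega> \<in> seen n (\<epsilon> n \<omega>) \<omega>)}"
      then have \<omega>: "\<omega> \<in> space P" "\<omega> \<in> cylinder (n - 1) \<omega>\<^sub>0"
        "\<not> (X n \<omega> \<in> seen n (\<epsilon> n \<omega>) \<omega> \<and> Y n \<omega> \<in> seen n (\<epsilon> n \<omega>) \<omega>)" by auto
      moreover have "seen n (\<epsilon> n \<omega>) \<omega> = seen n (\<epsilon> n \<omega>) \<omega>\<^sub>0"
        by (rule adapted_cylinder[OF adapted_seen \<omega>(2)]) simp
      ultimately have "\<omega> \<in> ?N (\<epsilon> n \<omega>)" by simp
      then show "\<omega> \<in> (\<Union>j\<in>I. ?N j)" using step_range[OF \<omega>(1) assms] by blast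
    qed
  qed
qed

lemma AE_prefix: "AE \<omega> in P. \<forall>n. prefix n \<omega>"
proof -
  have "AE \<omega> in P. 1 \<le> n \<longrightarrow> X n \<omega> \<in> seen n (\<epsilon> n \<omega>) \<omega> \<and> Y n \<omega> \<in> seen n (\<epsilon> n \<omega>) \<omega>" for n
  proof (cases "1 \<le> n")
    case True
    show ?thesis using AE_parents_seen[OF True] by eventually_elim blast
  qed (rule AE_I2, blast)
  then have "AE \<omega> in P. \<forall>n. 1 \<le> n \<longrightarrow> X n \<omega> \<in> seen n (\<epsilon> n \<omega>) \<omega> \<and> Y n \<omega> \<in> seen n (\<epsilon> n \<omega>) \<omega>"
    unfolding AE_all_countable by (rule allI)
  with AE_space show ?thesis
  proof eventually_elim
    case (elim \<omega>)
    show ?case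
    proof (intro allI tangle_prefix.intro)
      fix m :: nat assume "1 \<le> m"
      then have "\<Theta> m \<omega> \<in> h ` {1..M}" "\<epsilon> m \<omega> \<in> I" using step_range elim by auto
      then show "\<Theta> m \<omega> \<le> h M" "\<epsilon> m \<omega> \<le> Max I" "1 \<le> \<epsilon> m \<omega>"
        using strict_mono_on_leD[OF h_mono] M_ge_2 finite_I I_pos[of "\<epsilon> m \<omega>"]
        by (auto intro!: Max_ge)
    qed (use elim in auto)
  qed
qed

text \<open>An adapted event is a countable disjoint union of cylinders, so an estimate on each of
  them can be summed. The estimate is needed only on cylinders that satisfy \<open>prefix\<close>,
  as the others are null.\<close>

lemma prob_le_by_cylinders:
  assumes "adapted n E" and G: "G \<in> sets P" "G' \<in> sets P" and "0 \<le> c"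
    and le: "\<And>\<omega>\<^sub>0. \<omega>\<^sub>0 \<in> space P \<Longrightarrow> E \<omega>\<^sub>0 \<Longrightarrow> prefix n \<omega>\<^sub>0 \<Longrightarrow>
      prob (cylinder n \<omega>\<^sub>0 \<inter> G) \<le> c * prob (cylinder n \<omega>\<^sub>0 \<inter> G')"
  shows "prob ({\<omega> \<in> space P. E \<omega>} \<inter> G) \<le> c * prob ({\<omega> \<in> space P. E \<omega>} \<inter> G')"
proof -
  let ?E = "{\<omega> \<in> space P. E \<omega>}"
  let ?C = "\<lambda>l. hist n -` {l} \<inter> space P"
  have C: "?C l \<in> sets P" for l by measurable
  have split: "emeasure P (?E \<inter> G) = (\<integral>\<^sup>+l. emeasure P (?C l \<inter> G) \<partial>count_space (hist n ` ?E))"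
    if "G \<in> sets P" for G
  proof -
    have "?E \<inter> G = (\<Union>l\<in>hist n ` ?E. ?C l \<inter> G)"
    proof (intro equalityI subsetI)
      fix \<omega> assume "\<omega> \<in> ?E \<inter> G"
      then show "\<omega> \<in> (\<Union>l\<in>hist n ` ?E. ?C l \<inter> G)" by (intro UN_I[of "hist n \<omega>"]) auto
    next
      fix \<omega> assume "\<omega> \<in> (\<Union>l\<in>hist n ` ?E. ?C l \<inter> G)"
      then obtain \<omega>' where "E \<omega>'" "hist n \<omega> = hist n \<omega>'" "\<omega> \<in> space P" "\<omega> \<in> G" by auto
      then show "\<omega> \<in> ?E \<inter> G" using adaptedD[OF assms(1), of \<omega> \<omega>'] by simp
    qed
    moreover have "emeasure P (\<Union>l\<in>hist n ` ?E. ?C l \<inter> G)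
        = (\<integral>\<^sup>+l. emeasure P (?C l \<inter> G) \<partial>count_space (hist n ` ?E))"
      using C that by (intro emeasure_UN_countable) (auto simp: disjoint_family_on_def)
    ultimately show ?thesis by simp
  qed
  have "emeasure P (?C l \<inter> G) \<le> ennreal c * emeasure P (?C l \<inter> G')" if "l \<in> hist n ` ?E" for l
  proof -
    obtain \<omega>\<^sub>0 where \<omega>\<^sub>0: "\<omega>\<^sub>0 \<in> space P" "E \<omega>\<^sub>0" "hist n \<omega>\<^sub>0 = l" using \<open>l \<in> hist n ` ?E\<close> by blast
    then have eq: "?C l = cylinder n \<omega>\<^sub>0" unfolding cylinder_def by auto
    have "prob (cylinder n \<omega>\<^sub>0 \<inter> G) \<le> c * prob (cylinder n \<omega>\<^sub>0 \<inter> G')"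
    proof (cases "prefix n \<omega>\<^sub>0")
      case True
      then show ?thesis using le \<omega>\<^sub>0 by blast
    next
      case False
      \<comment> \<open>\<open>prefix n\<close> is constant on the cylinder, fails there, and yet
        holds almost surely.\<close>
      have "AE \<omega> in P. \<omega> \<notin> cylinder n \<omega>\<^sub>0"
        using AE_prefix
      proof eventually_elim
        case (elim \<omega>)
        then show ?case using False adapted_cylinder[OF adapted_prefix] by blast
      qed
      then have "prob (cylinder n \<omega>\<^sub>0) = 0"
        by (subst prob_eq_0) auto
      then have "prob (cylinder n \<omega>\<^sub>0 \<inter> G) = 0"
        using finite_measure_mono[of "cylinder n \<omega>\<^sub>0 \<inter> G" "cylinder n \<omega>\<^sub>0"]
          measure_nonneg[of P "cylinder n \<omega>\<^sub>0 \<inter> G"] by (simp add: antisym)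
      then show ?thesis using \<open>0 \<le> c\<close> by simp
    qed
    then show ?thesis
      unfolding eq emeasure_eq_measure using \<open>0 \<le> c\<close> by (simp flip: ennreal_mult)
  qed
  then have "emeasure P (?E \<inter> G)
      \<le> (\<integral>\<^sup>+l. ennreal c * emeasure P (?C l \<inter> G') \<partial>count_space (hist n ` ?E))"
    unfolding split[OF G(1)] by (intro nn_integral_mono) auto
  also have "\<dots> = ennreal c * emeasure P (?E \<inter> G')"
    unfolding split[OF G(2)] by (intro nn_integral_cmult) auto
  finally show ?thesis
    unfolding emeasure_eq_measure using \<open>0 \<le> c\<close> by (simp flip: ennreal_mult)
qed

end

section \<open>Every vertex is settled almost surely\<close>

text \<open>The function \<open>u n + 3 / (2 * c) * (q n + \<dots> + q (n + T - 1))\<close> decreases by at least \<open>q n / 2\<close>.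
  Spreading the \<open>T\<close>-step inequality over \<open>T\<close> summands makes the one-step inequality for \<open>u\<close>
  sufficient.\<close>

lemma lyapunov_decay:
  fixes u q lo :: "nat \<Rightarrow> real"
  assumes "0 < c" and u: "\<And>n. 0 \<le> u n" and q: "\<And>n. 0 \<le> q n" and "decseq q"
    and drift: "\<And>n. N \<le> n \<Longrightarrow> u (Suc n) \<le> u n - (q n - lo n) / 2 + lo n"
    and decay: "\<And>n. N \<le> n \<Longrightarrow> q (n + T) \<le> q n - c * lo n"
    and "0 < e"
  shows "\<exists>n. q n < e"
proof -
  define V where "V n = u n + 3 / (2 * c) * (\<Sum>i<T. q (n + i))" for n
  have step: "V (Suc n) \<le> V n - q n / 2" if "N \<le> n" for n
  proof -
    have "(\<Sum>i<T. q (Suc n + i)) + q n = (\<Sum>i<Suc T. q (n + i))"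
      by (subst sum.lessThan_Suc_shift) simp
    then have shift: "(\<Sum>i<T. q (Suc n + i)) = (\<Sum>i<T. q (n + i)) + (q (n + T) - q n)" by simp
    \<comment> \<open>The weight \<open>3 / (2 * c)\<close> is chosen so that the decay of
      \<open>q\<close> cancels the total contribution \<open>3 / 2 * lo n\<close> in the drift of
      \<open>u\<close>.\<close>
    have "3 / (2 * c) * (q (n + T) - q n) \<le> 3 / (2 * c) * (- (c * lo n))"
      using decay[OF that] \<open>0 < c\<close> by (intro mult_left_mono) auto
    also have "\<dots> = - (3 / 2 * lo n)" using \<open>0 < c\<close> by simp
    finally have "3 / (2 * c) * (q (n + T) - q n) \<le> - (3 / 2 * lo n)" .
    moreover have "u (Suc n) \<le> u n - q n / 2 + 3 / 2 * lo n" using drift[OF that] by argo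
    ultimately show ?thesis unfolding V_def shift distrib_left by linarith
  qed
  have V_ge: "0 \<le> V n" for n
    unfolding V_def using u q \<open>0 < c\<close> by (intro add_nonneg_nonneg mult_nonneg_nonneg sum_nonneg) auto
  \<comment> \<open>Since \<open>q\<close> decreases, each of the \<open>m\<close> decrements of
    \<open>V\<close> is at least \<open>q (N + m) / 2\<close>.\<close>
  have bound: "V (N + m) + real m * q (N + m) / 2 \<le> V N" for m
  proof (induction m)
    case (Suc m)
    have "real (Suc m) * q (N + Suc m) \<le> real (Suc m) * q (N + m)"
      using \<open>decseq q\<close> by (intro mult_left_mono) (auto simp: decseq_def)
    then show ?case using Suc step[of "N + m"] by (simp add: distrib_right) argo
  qed simp
  obtain m where m: "2 * V N / e < real m" using reals_Archimedean2 by blast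
  moreover have "0 \<le> 2 * V N / e" using V_ge[of N] \<open>0 < e\<close> by simp
  ultimately have "0 < real m" by linarith
  have "real m * q (N + m) \<le> 2 * V N" using bound[of m] V_ge[of "N + m"] by argo
  also have "\<dots> < real m * e" using m \<open>0 < e\<close> by (simp add: field_simps)
  finally have "q (N + m) < e" using \<open>0 < real m\<close> by simp
  then show ?thesis by blast
qed

context tangle_model
begin

section \<open>Bounds for the choice of parents\<close>

lemma adapted_approves:
  "w \<le> n \<Longrightarrow> adapted n (\<lambda>\<omega>. approves (\<lambda>m. X m \<omega>) (\<lambda>m. Y m \<omega>) v w)"
  unfolding adapted_def hist_eq_iff by (intro allI impI approves_cong) auto

lemma adapted_unsettled_tips:
  "adapted n (\<lambda>\<omega>. unsettled_tips (\<lambda>m. X m \<omega>) (\<lambda>m. Y m \<omega>) v n)"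
  unfolding adapted_def hist_eq_iff by (intro allI impI unsettled_tips_cong) auto

lemma adapted_comp2: "adapted n f \<Longrightarrow> adapted n f' \<Longrightarrow> adapted n (\<lambda>\<omega>. g (f \<omega>) (f' \<omega>))"
  unfolding adapted_def by metis

lemma adapted_step: "adapted (Suc n) (X (Suc n))" "adapted (Suc n) (Y (Suc n))"
  unfolding adapted_def hist_eq_iff by auto

lemma lag_bounds: "j \<in> I \<Longrightarrow> 1 \<le> j \<and> j \<le> Max I"
  using I_pos[of j] finite_I by auto

lemma cylinder_Int_space: "cylinder n \<omega>\<^sub>0 \<inter> space P = cylinder n \<omega>\<^sub>0"
  unfolding cylinder_def by blast

text \<open>A bound on the share of bad pairs that is uniform in the lag survives averaging over the
  lag.\<close>

lemma prob_cylinder_parents_le: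
  fixes \<omega>\<^sub>0 :: 'a
  assumes "0 \<le> \<alpha>"
    and "\<And>j. j \<in> I \<Longrightarrow> real (card (S \<inter> seen (Suc n) j \<omega>\<^sub>0 \<times> seen (Suc n) j \<omega>\<^sub>0))
      \<le> \<alpha> * (real (card (seen (Suc n) j \<omega>\<^sub>0)))\<^sup>2"
  shows "prob (cylinder n \<omega>\<^sub>0 \<inter> {\<omega> \<in> space P. (X (Suc n) \<omega>, Y (Suc n) \<omega>) \<in> S})
    \<le> \<alpha> * prob (cylinder n \<omega>\<^sub>0)"
proof -
  let ?C = "cylinder n \<omega>\<^sub>0"
  let ?A = "\<lambda>j. ?C \<inter> {\<omega> \<in> space P. \<epsilon> (Suc n) \<omega> = j \<and> (X (Suc n) \<omega>, Y (Suc n) \<omega>) \<in> S}"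
  have A: "?A j \<in> sets P" for j
    using step_event[of "Suc n" "\<lambda>_ e x y. e = j \<and> (x, y) \<in> S"] by auto
  have eq: "?C \<inter> {\<omega> \<in> space P. (X (Suc n) \<omega>, Y (Suc n) \<omega>) \<in> S} = (\<Union>j\<in>I. ?A j)"
    using step_range[of _ "Suc n"] by auto
  have "prob (?C \<inter> {\<omega> \<in> space P. (X (Suc n) \<omega>, Y (Suc n) \<omega>) \<in> S}) \<le> (\<Sum>j\<in>I. prob (?A j))"
    unfolding eq using A by (intro finite_measure_subadditive_finite finite_I) blast
  also have "\<dots> \<le> (\<Sum>j\<in>I. prob ?C * p\<epsilon> j * \<alpha>)"
  proof (rule sum_mono)
    fix j assume j: "j \<in> I"
    let ?L = "seen (Suc n) j \<omega>\<^sub>0"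
    \<comment> \<open>If no tip is visible, the quotient is 0, as division by zero returns
      0.\<close>
    have "card (S \<inter> ?L \<times> ?L) / (real (card ?L))\<^sup>2 \<le> \<alpha>"
      using assms(2)[OF j] \<open>0 \<le> \<alpha>\<close> by (cases "card ?L = 0") (auto simp: divide_le_eq)
    then have "prob ?C * p\<epsilon> j * (card (S \<inter> ?L \<times> ?L) / (real (card ?L))\<^sup>2) \<le> prob ?C * p\<epsilon> j * \<alpha>"
      using p\<epsilon>_pos[OF j] by (intro mult_left_mono) auto
    then show "prob (?A j) \<le> prob ?C * p\<epsilon> j * \<alpha>"
      using prob_cylinder_parents[of "Suc n" j \<omega>\<^sub>0 S] j by simp
  qed
  also have "\<dots> = (\<Sum>j\<in>I. p\<epsilon> j) * (\<alpha> * prob ?C)"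
    unfolding sum_distrib_right by (intro sum.cong refl) simp
  finally show ?thesis using p\<epsilon>_sum by simp
qed

text \<open>For every lag, one prescribed pair of at most \<open>c\<close> visible tips is picked
  with conditional probability at least \<open>1 / c\<^sup>2\<close>.\<close>

lemma prob_cylinder_le_choice:
  fixes \<omega>\<^sub>0 :: 'a
  assumes s: "\<And>j. j \<in> I \<Longrightarrow> s j \<in> seen (Suc n) j \<omega>\<^sub>0 \<times> seen (Suc n) j \<omega>\<^sub>0"
    and c: "\<And>j. j \<in> I \<Longrightarrow> card (seen (Suc n) j \<omega>\<^sub>0) \<le> c"
    and G: "G \<in> sets P" "\<And>\<omega>. \<omega> \<in> cylinder n \<omega>\<^sub>0 \<Longrightarrow>
      (X (Suc n) \<omega>, Y (Suc n) \<omega>) = s (\<epsilon> (Suc n) \<omega>) \<Longrightarrow> \<omega> \<in> G"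
  shows "prob (cylinder n \<omega>\<^sub>0) \<le> (real c)\<^sup>2 * prob (cylinder n \<omega>\<^sub>0 \<inter> G)"
proof -
  let ?C = "cylinder n \<omega>\<^sub>0"
  let ?A = "\<lambda>j. ?C \<inter> {\<omega> \<in> space P. \<epsilon> (Suc n) \<omega> = j \<and> (X (Suc n) \<omega>, Y (Suc n) \<omega>) \<in> {s j}}"
  have A: "?A j \<in> sets P" for j
    using step_event[of "Suc n" "\<lambda>_ e x y. e = j \<and> (x, y) \<in> {s j}"] by auto
  have prob_A: "prob ?C * p\<epsilon> j \<le> (real c)\<^sup>2 * prob (?A j)" if j: "j \<in> I" for j
  proof -
    let ?L = "seen (Suc n) j \<omega>\<^sub>0"
    have fin: "finite ?L" by (simp add: visible_tips_def finite_tips_tangle_nat)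
    have "{s j} \<inter> ?L \<times> ?L = {s j}" using s[OF j] by blast
    then have eq: "prob (?A j) = prob ?C * p\<epsilon> j * (1 / (real (card ?L))\<^sup>2)"
      using prob_cylinder_parents[of "Suc n" j \<omega>\<^sub>0 "{s j}"] j by simp
    have "?L \<noteq> {}" using s[OF j] by auto
    then have "0 < card ?L" using fin by (simp add: card_gt_0_iff)
    then have "1 \<le> (real c)\<^sup>2 * (1 / (real (card ?L))\<^sup>2)"
      using power_mono[of "real (card ?L)" "real c" 2] c[OF j] by (simp add: field_simps)
    then have "prob ?C * p\<epsilon> j * 1 \<le> prob ?C * p\<epsilon> j * ((real c)\<^sup>2 * (1 / (real (card ?L))\<^sup>2))"
      using p\<epsilon>_pos[OF j] by (intro mult_left_mono) auto
    then show ?thesis unfolding eq by (simp add: algebra_simps)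
  qed
  have "prob ?C = (\<Sum>j\<in>I. prob ?C * p\<epsilon> j)"
    unfolding sum_distrib_left[symmetric] p\<epsilon>_sum by simp
  also have "\<dots> \<le> (\<Sum>j\<in>I. (real c)\<^sup>2 * prob (?A j))" by (intro sum_mono prob_A)
  also have "\<dots> = (real c)\<^sup>2 * (\<Sum>j\<in>I. prob (?A j))" by (simp add: sum_distrib_left)
  also have "(\<Sum>j\<in>I. prob (?A j)) = prob (\<Union>j\<in>I. ?A j)"
    using finite_I A
    by (intro finite_measure_finite_Union[symmetric]) (auto simp: disjoint_family_on_def)
  also have "\<dots> \<le> prob (?C \<inter> G)"
    using G A by (intro finite_measure_mono) auto
  finally show ?thesis by (simp add: mult_left_mono)
qed

text \<open>By time \<open>n\<close> the vertex \<open>v\<close> is visible under every lag, so some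
  visible tip approves it. That tip is the first parent; the second is a visible unsettled tip, or
  the same tip again if there is none.\<close>

lemma prob_favourable:
  assumes n: "v + h M + Max I \<le> n" and E: "adapted n E"
    and c: "\<And>\<omega>. \<omega> \<in> space P \<Longrightarrow> E \<omega> \<Longrightarrow> prefix n \<omega> \<Longrightarrow> card (free n \<omega>) \<le> c"
  shows "prob {\<omega> \<in> space P. E \<omega>} \<le> (real (c + 2 * (h M + Max I)))\<^sup>2
    * prob ({\<omega> \<in> space P. E \<omega>} \<inter> {\<omega> \<in> space P. favourable v (Suc n) \<omega>})"
proof -
  let ?E = "{\<omega> \<in> space P. E \<omega>}" and ?F = "{\<omega> \<in> space P. favourable v (Suc n) \<omega>}"
  have F: "?F \<in> sets P" by (rule adapted_event[OF adapted_favourable])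
  have "prob (?E \<inter> space P) \<le> (real (c + 2 * (h M + Max I)))\<^sup>2 * prob (?E \<inter> ?F)"
  proof (rule prob_le_by_cylinders[OF E _ F])
    fix \<omega>\<^sub>0 assume \<omega>\<^sub>0: "\<omega>\<^sub>0 \<in> space P" "E \<omega>\<^sub>0" "prefix n \<omega>\<^sub>0"
    interpret T: tangle_prefix "\<lambda>m. \<Theta> m \<omega>\<^sub>0" "\<lambda>m. \<epsilon> m \<omega>\<^sub>0" "\<lambda>m. X m \<omega>\<^sub>0" "\<lambda>m. Y m \<omega>\<^sub>0" "h M" "Max I" n
      by fact
    let ?U = "unsettled_tips (\<lambda>m. X m \<omega>\<^sub>0) (\<lambda>m. Y m \<omega>\<^sub>0) v n"
    let ?app = "approves (\<lambda>m. X m \<omega>\<^sub>0) (\<lambda>m. Y m \<omega>\<^sub>0) v"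
    let ?ok = "\<lambda>j s. fst s \<in> seen (Suc n) j \<omega>\<^sub>0 \<and> snd s \<in> seen (Suc n) j \<omega>\<^sub>0 \<and> ?app (fst s)
      \<and> (seen (Suc n) j \<omega>\<^sub>0 \<inter> ?U \<noteq> {} \<longrightarrow> snd s \<in> ?U)"
    have "\<exists>s. ?ok j s" if j: "j \<in> I" for j
    proof -
      have "v = 0 \<or> v + \<Theta> v \<omega>\<^sub>0 < Suc n - j"
        using T.duration_le[of v] n lag_bounds[OF j] by (cases "v = 0") auto
      then obtain g where g: "g \<in> seen (Suc n) j \<omega>\<^sub>0" "?app g"
        using T.approving_tip_exists[of "Suc n - j" v] unfolding visible_tips_def by auto
      show ?thesis
      proof (cases "seen (Suc n) j \<omega>\<^sub>0 \<inter> ?U = {}")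
        case True
        then show ?thesis using g by (intro exI[of _ "(g, g)"]) simp
      next
        case False
        then obtain b where "b \<in> seen (Suc n) j \<omega>\<^sub>0 \<inter> ?U" by blast
        then show ?thesis using g by (intro exI[of _ "(g, b)"]) simp
      qed
    qed
    then obtain s where s: "\<And>j. j \<in> I \<Longrightarrow> ?ok j (s j)" by metis
    have "prob (cylinder n \<omega>\<^sub>0) \<le> (real (c + 2 * (h M + Max I)))\<^sup>2 * prob (cylinder n \<omega>\<^sub>0 \<inter> ?F)"
    proof (rule prob_cylinder_le_choice[of s])
      fix j assume j: "j \<in> I"
      show "s j \<in> seen (Suc n) j \<omega>\<^sub>0 \<times> seen (Suc n) j \<omega>\<^sub>0"
        using s[OF j] by (simp add: mem_Times_iff)
      show "card (seen (Suc n) j \<omega>\<^sub>0) \<le> c + 2 * (h M + Max I)"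
        using T.card_visible_tips_le[of "Suc n" j] lag_bounds[OF j] c[OF \<omega>\<^sub>0] by simp
    next
      fix \<omega> assume \<omega>: "\<omega> \<in> cylinder n \<omega>\<^sub>0" "(X (Suc n) \<omega>, Y (Suc n) \<omega>) = s (\<epsilon> (Suc n) \<omega>)"
      have sp: "\<omega> \<in> space P" using \<omega>(1) by (simp add: cylinder_def)
      let ?j = "\<epsilon> (Suc n) \<omega>"
      have j: "?j \<in> I" using step_range[OF sp] by simp
      have ok: "X (Suc n) \<omega> \<in> seen (Suc n) ?j \<omega>\<^sub>0" "?app (X (Suc n) \<omega>)"
        "seen (Suc n) ?j \<omega>\<^sub>0 \<inter> ?U \<noteq> {} \<longrightarrow> Y (Suc n) \<omega> \<in> ?U"
        using s[OF j] unfolding \<omega>(2)[symmetric] by simp_all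
      have X: "X (Suc n) \<omega> < Suc n"
        using T.visible_tips_less[OF _ _ ok(1)] lag_bounds[OF j] by simp
      have "seen (Suc n) ?j \<omega> = seen (Suc n) ?j \<omega>\<^sub>0"
        by (rule adapted_cylinder[OF adapted_seen \<omega>(1)]) simp
      moreover have "unsettled_tips (\<lambda>m. X m \<omega>) (\<lambda>m. Y m \<omega>) v n = ?U"
        by (rule adapted_cylinder[OF adapted_unsettled_tips \<omega>(1)])
      moreover have "approves (\<lambda>m. X m \<omega>) (\<lambda>m. Y m \<omega>) v (X (Suc n) \<omega>) = ?app (X (Suc n) \<omega>)"
        by (rule adapted_cylinder[OF adapted_approves \<omega>(1)]) (use X in simp)
      ultimately show "\<omega> \<in> ?F"
        using ok X sp unfolding favourable_choice_def by simp
    qed (rule F)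
    then show "prob (cylinder n \<omega>\<^sub>0 \<inter> space P)
        \<le> (real (c + 2 * (h M + Max I)))\<^sup>2 * prob (cylinder n \<omega>\<^sub>0 \<inter> ?F)"
      by (simp only: cylinder_Int_space)
  qed simp_all
  then show ?thesis by (simp add: Int_absorb2)
qed

text \<open>With at least \<open>9 * l + 2\<close> unreferenced vertices, at least
  \<open>8 * l + 2\<close> tips are visible, and at most \<open>2 * l\<close> of these are already
  referenced. The threshold is chosen so that the three bounds add up to
  \<open>(4 * l + 1) / (8 * l + 2) = 1 / 2\<close>.\<close>

lemma prob_not_new_le:
  fixes n :: nat
  defines "l \<equiv> h M + Max I"
  assumes E: "adapted n E"
    and large: "\<And>\<omega>. \<omega> \<in> space P \<Longrightarrow> E \<omega> \<Longrightarrow> prefix n \<omega> \<Longrightarrow> 9 * l + 2 \<le> card (free n \<omega>)"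
  shows "prob ({\<omega> \<in> space P. E \<omega>} \<inter> {\<omega> \<in> space P. X (Suc n) \<omega> \<notin> free n \<omega>})
    \<le> 2 * real l / (8 * real l + 2) * prob {\<omega> \<in> space P. E \<omega>}" (is ?X)
    and "prob ({\<omega> \<in> space P. E \<omega>} \<inter> {\<omega> \<in> space P. Y (Suc n) \<omega> \<notin> free n \<omega>})
    \<le> 2 * real l / (8 * real l + 2) * prob {\<omega> \<in> space P. E \<omega>}" (is ?Y)
    and "prob ({\<omega> \<in> space P. E \<omega>} \<inter> {\<omega> \<in> space P. X (Suc n) \<omega> = Y (Suc n) \<omega>})
    \<le> 1 / (8 * real l + 2) * prob {\<omega> \<in> space P. E \<omega>}" (is ?Z)
proof -
  have free: "adapted (Suc n) (free n)" by (rule adapted_mono[OF adapted_free]) simp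
  \<comment> \<open>On a cylinder each of the three estimates reduces to counting pairs of visible
    tips.\<close>
  have key: "prob ({\<omega> \<in> space P. E \<omega>} \<inter> {\<omega> \<in> space P. Q (free n \<omega>) (X (Suc n) \<omega>) (Y (Suc n) \<omega>)})
      \<le> \<alpha> * prob {\<omega> \<in> space P. E \<omega>}"
    if "0 \<le> \<alpha>" and few: "\<And>L U. finite L \<Longrightarrow> 8 * l + 2 \<le> card L \<Longrightarrow> card (L - U) \<le> 2 * l \<Longrightarrow>
      real (card ({s. Q U (fst s) (snd s)} \<inter> L \<times> L)) \<le> \<alpha> * (real (card L))\<^sup>2"
    for Q :: "nat set \<Rightarrow> nat \<Rightarrow> nat \<Rightarrow> bool" and \<alpha>
  proof -
    let ?E = "{\<omega> \<in> space P. E \<omega>}"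
    let ?G = "{\<omega> \<in> space P. Q (free n \<omega>) (X (Suc n) \<omega>) (Y (Suc n) \<omega>)}"
    have G: "?G \<in> sets P"
      by (rule adapted_event[of "Suc n"])
        (use free adapted_step[of n] in \<open>unfold adapted_def, metis\<close>)
    have "prob (?E \<inter> ?G) \<le> \<alpha> * prob (?E \<inter> space P)"
    proof (rule prob_le_by_cylinders[OF E G _ \<open>0 \<le> \<alpha>\<close>])
      fix \<omega>\<^sub>0 assume \<omega>\<^sub>0: "\<omega>\<^sub>0 \<in> space P" "E \<omega>\<^sub>0" "prefix n \<omega>\<^sub>0"
      interpret T: tangle_prefix "\<lambda>m. \<Theta> m \<omega>\<^sub>0" "\<lambda>m. \<epsilon> m \<omega>\<^sub>0" "\<lambda>m. X m \<omega>\<^sub>0" "\<lambda>m. Y m \<omega>\<^sub>0" "h M" "Max I" n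
        by fact
      let ?S = "{s. Q (free n \<omega>\<^sub>0) (fst s) (snd s)}"
      have eq: "cylinder n \<omega>\<^sub>0 \<inter> ?G
          = cylinder n \<omega>\<^sub>0 \<inter> {\<omega> \<in> space P. (X (Suc n) \<omega>, Y (Suc n) \<omega>) \<in> ?S}"
        using adapted_cylinder[OF adapted_free] by auto
      show "prob (cylinder n \<omega>\<^sub>0 \<inter> ?G) \<le> \<alpha> * prob (cylinder n \<omega>\<^sub>0 \<inter> space P)"
        unfolding eq cylinder_Int_space
      proof (rule prob_cylinder_parents_le[OF \<open>0 \<le> \<alpha>\<close>], rule few)
        fix j assume j: "j \<in> I"
        show "finite (seen (Suc n) j \<omega>\<^sub>0)" by (simp add: visible_tips_def finite_tips_tangle_nat)
        show "8 * l + 2 \<le> card (seen (Suc n) j \<omega>\<^sub>0)"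
          using T.card_visible_tips_ge[of "Suc n" j] lag_bounds[OF j] large[OF \<omega>\<^sub>0]
          unfolding l_def by simp
        show "card (seen (Suc n) j \<omega>\<^sub>0 - free n \<omega>\<^sub>0) \<le> 2 * l"
          using T.card_recently_referenced[of "Suc n" j] lag_bounds[OF j] unfolding l_def by simp
      qed
    qed simp
    then show ?thesis by (simp add: Int_absorb2)
  qed
  have old: "real (card (L - U) * card L) \<le> 2 * real l / (8 * real l + 2) * (real (card L))\<^sup>2"
    if "8 * l + 2 \<le> card L" "card (L - U) \<le> 2 * l" for L U :: "nat set"
  proof -
    have "real (card (L - U)) * (8 * real l + 2) \<le> 2 * real l * real (card L)"
      using of_nat_mono[where 'a = real, OF that(1)] of_nat_mono[where 'a = real, OF that(2)]
      by (intro mult_mono) simp_all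
    then have "real (card (L - U)) \<le> 2 * real l / (8 * real l + 2) * real (card L)"
      by (simp add: pos_le_divide_eq)
    then have "real (card (L - U)) * real (card L) \<le> 2 * real l / (8 * real l + 2) * real (card L) * real (card L)"
      by (rule mult_right_mono) simp
    then show ?thesis by (simp add: power2_eq_square mult.assoc)
  qed
  show ?X
  proof (rule key[of _ "\<lambda>U x y. x \<notin> U"])
    fix L U :: "nat set" assume "8 * l + 2 \<le> card L" "card (L - U) \<le> 2 * l"
    moreover have "{s. fst s \<notin> U} \<inter> L \<times> L = (L - U) \<times> L" by auto
    ultimately show "real (card ({s. fst s \<notin> U} \<inter> L \<times> L)) \<le> 2 * real l / (8 * real l + 2) * (real (card L))\<^sup>2"
      using old by (simp add: card_cartesian_product)
  qed simp
  show ?Y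
  proof (rule key[of _ "\<lambda>U x y. y \<notin> U"])
    fix L U :: "nat set" assume "8 * l + 2 \<le> card L" "card (L - U) \<le> 2 * l"
    moreover have "{s. snd s \<notin> U} \<inter> L \<times> L = L \<times> (L - U)" by auto
    ultimately show "real (card ({s. snd s \<notin> U} \<inter> L \<times> L)) \<le> 2 * real l / (8 * real l + 2) * (real (card L))\<^sup>2"
      using old by (simp add: card_cartesian_product mult.commute)
  qed simp
  show ?Z
  proof (rule key[of _ "\<lambda>U x y. x = y"])
    fix L :: "nat set" assume L: "finite L" "8 * l + 2 \<le> card L"
    have "{s. fst s = snd s} \<inter> L \<times> L = (\<lambda>x. (x, x)) ` L" by force
    then have "card ({s. fst s = snd s} \<inter> L \<times> L) = card L"
      by (simp add: card_image inj_on_def)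
    moreover have "real (card L) * (8 * l + 2) \<le> real (card L) * real (card L)"
      using of_nat_mono[where 'a = real, OF L(2)] by (intro mult_left_mono) simp_all
    ultimately show "real (card ({s. fst s = snd s} \<inter> L \<times> L)) \<le> 1 / (8 * real l + 2) * (real (card L))\<^sup>2"
      by (simp add: pos_le_divide_eq power2_eq_square add.commute)
  qed simp
qed

text \<open>From fewer than \<open>k\<close> unreferenced vertices, \<open>T\<close> favourable
  steps in a row settle \<open>v\<close>. The number of unreferenced vertices grows by at most one
  per step, so at most \<open>k + T + 2 * l\<close> tips are ever visible meanwhile, and each step
  costs at most a factor \<open>R\<close>.\<close>

lemma prob_open_decay:
  fixes v n k :: nat
  defines "l \<equiv> h M + Max I"
  defines "T \<equiv> 2 * l + k"
  defines "R \<equiv> (real (k + T + 2 * l))\<^sup>2"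
  assumes n: "v + l \<le> n"
  shows "prob {\<omega> \<in> space P. open_at v n \<omega> \<and> card (free n \<omega>) < k}
    \<le> R ^ T * (prob {\<omega> \<in> space P. open_at v n \<omega>} - prob {\<omega> \<in> space P. open_at v (n + T) \<omega>})"
proof -
  define Q where "Q i \<omega> \<longleftrightarrow> (open_at v n \<omega> \<and> card (free n \<omega>) < k)
    \<and> (\<forall>i'<i. favourable v (Suc (n + i')) \<omega>)" for i \<omega>
  have adapted_Q: "adapted (n + i) (Q i)" for i
  proof (induction i)
    case 0
    have "adapted n (\<lambda>\<omega>. open_at v n \<omega> \<and> card (free n \<omega>) < k)"
      by (rule adapted_comp2[OF adapted_open_at adapted_free])
    then show ?case unfolding Q_def by simp
  next
    case (Suc i)
    have "Q (Suc i) = (\<lambda>\<omega>. Q i \<omega> \<and> favourable v (Suc (n + i)) \<omega>)"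
      unfolding Q_def by (auto simp: less_Suc_eq)
    then show ?case
      using adapted_comp2[OF adapted_mono[OF Suc, of "Suc (n + i)"] adapted_favourable, of "(\<and>)"] by simp
  qed
  have growth: "card (free (n + i) \<omega>) \<le> k + i" if "card (free n \<omega>) < k" "prefix (n + i) \<omega>" for i \<omega>
  proof -
    have "card (free (n + i') \<omega>) \<le> k + i'" if "i' \<le> i" for i'
      using that
    proof (induction i')
      case (Suc i')
      then show ?case
        using tangle_prefix.card_unreferenced_Suc_le[OF \<open>prefix (n + i) \<omega>\<close>, of "n + i'"] by simp
    qed (use \<open>card (free n \<omega>) < k\<close> in simp)
    then show ?thesis by simp
  qed
  have step: "prob {\<omega> \<in> space P. Q i \<omega>} \<le> R * prob {\<omega> \<in> space P. Q (Suc i) \<omega>}" if "i \<le> T" for i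
  proof -
    have "prob {\<omega> \<in> space P. Q i \<omega>} \<le> (real (k + T + 2 * (h M + Max I)))\<^sup>2
      * prob ({\<omega> \<in> space P. Q i \<omega>} \<inter> {\<omega> \<in> space P. favourable v (Suc (n + i)) \<omega>})"
    proof (rule prob_favourable[OF _ adapted_Q])
      fix \<omega> assume "Q i \<omega>" "prefix (n + i) \<omega>"
      then show "card (free (n + i) \<omega>) \<le> k + T" using growth[of \<omega> i] that unfolding Q_def by simp
    qed (use n in \<open>simp add: l_def\<close>)
    also have "{\<omega> \<in> space P. Q i \<omega>} \<inter> {\<omega> \<in> space P. favourable v (Suc (n + i)) \<omega>}
        = {\<omega> \<in> space P. Q (Suc i) \<omega>}"
      unfolding Q_def by (auto simp: less_Suc_eq)
    finally show ?thesis unfolding R_def l_def .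
  qed
  have "prob {\<omega> \<in> space P. Q 0 \<omega>} \<le> R ^ i * prob {\<omega> \<in> space P. Q i \<omega>}" if "i \<le> T" for i
    using that
  proof (induction i)
    case (Suc i)
    then have "prob {\<omega> \<in> space P. Q 0 \<omega>} \<le> R ^ i * prob {\<omega> \<in> space P. Q i \<omega>}" by simp
    also have "\<dots> \<le> R ^ i * (R * prob {\<omega> \<in> space P. Q (Suc i) \<omega>})"
      using step[of i] Suc.prems by (intro mult_left_mono) (auto simp: R_def)
    finally show ?case by (simp add: mult.assoc mult.left_commute)
  qed simp
  then have "prob {\<omega> \<in> space P. Q 0 \<omega>} \<le> R ^ T * prob {\<omega> \<in> space P. Q T \<omega>}" by simp
  also have "prob {\<omega> \<in> space P. Q T \<omega>}
      \<le> prob ({\<omega> \<in> space P. open_at v n \<omega>} - {\<omega> \<in> space P. open_at v (n + T) \<omega>})"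
  proof (rule finite_measure_mono_AE)
    show "AE \<omega> in P. \<omega> \<in> {\<omega> \<in> space P. Q T \<omega>} \<longrightarrow>
        \<omega> \<in> {\<omega> \<in> space P. open_at v n \<omega>} - {\<omega> \<in> space P. open_at v (n + T) \<omega>}"
      using AE_prefix
    proof eventually_elim
      case (elim \<omega>)
      have "\<not> open_at v (n + T) \<omega>" if "Q T \<omega>"
        using tangle_prefix.favourable_choices_settle[of "\<lambda>m. \<Theta> m \<omega>" "\<lambda>m. \<epsilon> m \<omega>" "\<lambda>m. X m \<omega>"
          "\<lambda>m. Y m \<omega>" "h M" "Max I" "n + T" k v n] elim that
        unfolding Q_def T_def l_def by simp
      then show ?case unfolding Q_def by auto
    qed
    show "{\<omega> \<in> space P. open_at v n \<omega>} - {\<omega> \<in> space P. open_at v (n + T) \<omega>} \<in> sets P"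
      by (intro sets.Diff adapted_event[OF adapted_open_at])
  qed
  also have "\<dots> = prob {\<omega> \<in> space P. open_at v n \<omega>} - prob {\<omega> \<in> space P. open_at v (n + T) \<omega>}"
    by (rule finite_measure_Diff) (auto intro: adapted_event[OF adapted_open_at] dest: settled_mono[of _ _ _ _ n "n + T"])
  finally show ?thesis unfolding Q_def by (simp add: mult_left_mono R_def)
qed

text \<open>While \<open>v\<close> is open, the count changes on average by at most
  \<open>- 1 + 1 / 2\<close> when it is large and by at most 1 otherwise. Setting it to 0 once
  \<open>v\<close> is settled ties the drift to the probability that \<open>v\<close> is still
  open.\<close>

lemma expected_unreferenced_drift:
  fixes v n :: nat
  defines "k \<equiv> 9 * (h M + Max I) + 2"
  defines "u \<equiv> \<lambda>n. \<integral>\<omega>. (if open_at v n \<omega> then real (card (free n \<omega>)) else 0) \<partial>P"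
  shows "u (Suc n) \<le> u n
    - (prob {\<omega> \<in> space P. open_at v n \<omega>} - prob {\<omega> \<in> space P. open_at v n \<omega> \<and> card (free n \<omega>) < k}) / 2
    + prob {\<omega> \<in> space P. open_at v n \<omega> \<and> card (free n \<omega>) < k}"
proof -
  define l where "l = h M + Max I"
  define f where "f n \<omega> = (if open_at v n \<omega> then real (card (free n \<omega>)) else 0)" for n \<omega>
  define Hi where "Hi = {\<omega> \<in> space P. open_at v n \<omega> \<and> k \<le> card (free n \<omega>)}"
  define Lo where "Lo = {\<omega> \<in> space P. open_at v n \<omega> \<and> card (free n \<omega>) < k}"
  let ?A = "Hi \<inter> {\<omega> \<in> space P. X (Suc n) \<omega> \<notin> free n \<omega>}"
  let ?B = "Hi \<inter> {\<omega> \<in> space P. Y (Suc n) \<omega> \<notin> free n \<omega>}"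
  let ?C = "Hi \<inter> {\<omega> \<in> space P. X (Suc n) \<omega> = Y (Suc n) \<omega>}"
  have adapted_hi: "adapted n (\<lambda>\<omega>. open_at v n \<omega> \<and> k \<le> card (free n \<omega>))"
    by (rule adapted_comp2[OF adapted_open_at adapted_free])
  have free: "adapted (Suc n) (free n)" by (rule adapted_mono[OF adapted_free]) simp
  have Hi: "Hi \<in> sets P" unfolding Hi_def by (rule adapted_event[OF adapted_hi])
  have Lo: "Lo \<in> sets P" unfolding Lo_def
    by (rule adapted_event[of n]) (rule adapted_comp2[OF adapted_open_at adapted_free])
  have A: "?A \<in> sets P"
    by (intro sets.Int Hi adapted_event[of "Suc n"] adapted_comp2[OF adapted_step(1) free])
  have B: "?B \<in> sets P"
    by (intro sets.Int Hi adapted_event[of "Suc n"] adapted_comp2[OF adapted_step(2) free])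
  have C: "?C \<in> sets P"
    by (intro sets.Int Hi adapted_event[of "Suc n"] adapted_comp2[OF adapted_step])
  have int_f: "integrable P (f n)" for n
  proof (rule integrable_const_bound[where B = "real (n + 1)"])
    have "adapted n (f n)"
      unfolding f_def by (rule adapted_comp2[OF adapted_open_at adapted_free])
    from measurable_comp[OF adapted_measurable[OF this], of id borel]
    show "f n \<in> borel_measurable P" by simp
    show "AE \<omega> in P. norm (f n \<omega>) \<le> real (n + 1)"
      using card_unreferenced_le by (intro AE_I2) (auto simp: f_def simp flip: of_nat_Suc)
  qed
  have split: "prob {\<omega> \<in> space P. open_at v n \<omega>} = prob Hi + prob Lo"
  proof -
    have "{\<omega> \<in> space P. open_at v n \<omega>} = Hi \<union> Lo" unfolding Hi_def Lo_def by auto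
    moreover have "Hi \<inter> Lo = {}" unfolding Hi_def Lo_def by auto
    ultimately show ?thesis using finite_measure_Union[OF Hi Lo] by simp
  qed
  have int_ind: "integrable P (indicat_real S)" if "S \<in> sets P" for S
    using that by (intro integrable_real_indicator) (auto simp: emeasure_eq_measure)
  have "u (Suc n) = (\<integral>\<omega>. f (Suc n) \<omega> \<partial>P)" unfolding u_def f_def ..
  also have "\<dots> \<le> (\<integral>\<omega>. f n \<omega> - indicator Hi \<omega> + indicator ?A \<omega> + indicator ?B \<omega>
      + indicator ?C \<omega> + indicator Lo \<omega> \<partial>P)"
  proof (rule integral_mono_AE)
    show "AE \<omega> in P. f (Suc n) \<omega> \<le> f n \<omega> - indicator Hi \<omega> + indicator ?A \<omega> + indicator ?B \<omega>
      + indicator ?C \<omega> + indicator Lo \<omega>"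
      using AE_prefix AE_space
    proof eventually_elim
      case (elim \<omega>)
      then have prefix: "prefix (Suc n) \<omega>" by blast
      show ?case
      proof (cases "\<omega> \<in> Hi")
        case True
        then have hi: "open_at v n \<omega>" "k \<le> card (free n \<omega>)" "\<omega> \<notin> Lo"
          unfolding Hi_def Lo_def by auto
        have "real (card (free (Suc n) \<omega>)) + 1 \<le> real (card (free n \<omega>))
            + of_bool (X (Suc n) \<omega> \<notin> free n \<omega>) + of_bool (Y (Suc n) \<omega> \<notin> free n \<omega>)
            + of_bool (X (Suc n) \<omega> = Y (Suc n) \<omega>)"
          using of_nat_mono[where 'a = real, OF tangle_prefix.card_unreferenced_step[OF prefix, of "Suc n"]]
          by simp
        \<comment> \<open>This covers the case that \<open>v\<close> becomes settled in this very
          step: the left side drops to 0 and the right side stays nonnegative.\<close>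
        moreover have "1 \<le> real (card (free n \<omega>))" using hi unfolding k_def by simp
        ultimately show ?thesis
          using True hi elim unfolding f_def by (auto simp: indicator_def of_bool_def)
      next
        case False
        have "real (card (free (Suc n) \<omega>)) \<le> real (card (free n \<omega>)) + 1"
          using tangle_prefix.card_unreferenced_Suc_le[OF prefix, of n] by simp
        \<comment> \<open>A settled vertex stays settled, so outside \<open>Hi\<close> and
          \<open>Lo\<close> both sides are 0.\<close>
        moreover have "open_at v n \<omega>" if "open_at v (Suc n) \<omega>"
          using that settled_mono[of _ _ _ _ n "Suc n"] by auto
        ultimately show ?thesis
          using False elim unfolding f_def Hi_def Lo_def by (auto simp: indicator_def)
      qed
    qed
  qed (intro int_f Bochner_Integration.integrable_add Bochner_Integration.integrable_diff
      int_ind Hi A B C Lo)+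
  also have "\<dots> = u n - prob Hi + prob ?A + prob ?B + prob ?C + prob Lo"
    using int_f[of n] int_ind Hi A B C Lo unfolding u_def f_def[symmetric] by simp
  also have "\<dots> \<le> u n - prob Hi / 2 + prob Lo"
  proof -
    have ge: "9 * (h M + Max I) + 2 \<le> card (free n \<omega>)" if "open_at v n \<omega> \<and> k \<le> card (free n \<omega>)" for \<omega>
      using that unfolding k_def by simp
    have "prob ?A + prob ?B + prob ?C
        \<le> (2 * real l / (8 * real l + 2) + 2 * real l / (8 * real l + 2) + 1 / (8 * real l + 2)) * prob Hi"
      using prob_not_new_le[OF adapted_hi ge, folded Hi_def l_def] unfolding distrib_right by linarith
    also have "2 * real l / (8 * real l + 2) + 2 * real l / (8 * real l + 2) + 1 / (8 * real l + 2) = 1 / 2"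
      unfolding add_divide_distrib[symmetric] by (simp add: divide_simps)
    finally show ?thesis by simp
  qed
  finally show ?thesis unfolding split Lo_def[symmetric] by simp
qed

text \<open>The drift of the truncated mean of the count and the decay over \<open>2 * l + k\<close>
  steps are the two hypotheses of \<open>lyapunov_decay\<close>; hence the probability of being open
  falls below every \<open>e > 0\<close>.\<close>

lemma AE_settled:
  "AE \<omega> in P. \<exists>n. settled (\<lambda>m. X m \<omega>) (\<lambda>m. Y m \<omega>) v (h M + Max I) n"
proof -
  define l where "l = h M + Max I"
  define k where "k = 9 * l + 2"
  define R where "R = (real (k + (2 * l + k) + 2 * l))\<^sup>2 ^ (2 * l + k)"
  let ?q = "\<lambda>n. prob {\<omega> \<in> space P. open_at v n \<omega>}"
  let ?lo = "\<lambda>n. prob {\<omega> \<in> space P. open_at v n \<omega> \<and> card (free n \<omega>) < k}"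
  have "0 < R" unfolding R_def k_def by simp
  have "\<exists>n. ?q n < e" if "0 < e" for e
  proof (rule lyapunov_decay[where lo = ?lo and c = "1 / R" and N = "v + l"])
    show "decseq ?q"
    proof (rule decseq_SucI, rule finite_measure_mono)
      fix n
      show "{\<omega> \<in> space P. open_at v (Suc n) \<omega>} \<subseteq> {\<omega> \<in> space P. open_at v n \<omega>}"
        using settled_mono[of _ _ _ _ n "Suc n"] by auto
    qed (rule adapted_event[OF adapted_open_at])
  next
    fix n assume "v + l \<le> n"
    then show "?q (n + (2 * l + k)) \<le> ?q n - 1 / R * ?lo n"
      using prob_open_decay[of v n k] \<open>0 < R\<close> unfolding l_def[symmetric] R_def[symmetric]
      by (simp add: pos_divide_le_eq le_diff_eq diff_le_eq field_simps)
  next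
    fix n
    show "(\<integral>\<omega>. (if open_at v (Suc n) \<omega> then real (card (free (Suc n) \<omega>)) else 0) \<partial>P)
      \<le> (\<integral>\<omega>. (if open_at v n \<omega> then real (card (free n \<omega>)) else 0) \<partial>P) - (?q n - ?lo n) / 2 + ?lo n"
      using expected_unreferenced_drift[of v n] unfolding l_def[symmetric] k_def[symmetric] .
  qed (use that \<open>0 < R\<close> in \<open>auto intro!: integral_nonneg_AE\<close>)
  moreover have "prob {\<omega> \<in> space P. \<forall>n. open_at v n \<omega>} \<le> ?q n" for n
    by (rule finite_measure_mono) (auto intro: adapted_event[OF adapted_open_at])
  ultimately have "prob {\<omega> \<in> space P. \<forall>n. open_at v n \<omega>} \<le> e" if "0 < e" for e
    using that by (meson le_less_trans less_imp_le)
  then have "prob {\<omega> \<in> space P. \<forall>n. open_at v n \<omega>} = 0"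
    using field_le_epsilon[of "prob {\<omega> \<in> space P. \<forall>n. open_at v n \<omega>}" 0] by (simp add: antisym)
  moreover have "{\<omega> \<in> space P. \<forall>n. open_at v n \<omega>} \<in> sets P"
    by (intro sets.sets_Collect_countable_All adapted_event[OF adapted_open_at])
  ultimately have "AE \<omega> in P. \<not> (\<forall>n. open_at v n \<omega>)"
    using AE_iff_measurable[of "{\<omega> \<in> space P. \<forall>n. open_at v n \<omega>}" P "\<lambda>\<omega>. \<not> (\<forall>n. open_at v n \<omega>)"]
    by (simp add: emeasure_eq_measure)
  then show ?thesis by simp
qed

end

theorem theorem3p21:
  fixes P :: "'a measure"
    and M :: nat and h :: "nat \<Rightarrow> nat" and p\<Theta> :: "nat \<Rightarrow> real"
    and I :: "nat set" and p\<epsilon> :: "nat \<Rightarrow> real"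
    and \<Theta> \<epsilon> X Y :: "nat \<Rightarrow> 'a \<Rightarrow> nat"
  assumes "tangle_model P M h p\<Theta> I p\<epsilon> \<Theta> \<epsilon> X Y"
  shows "AE \<omega> in P.
    let G = (\<lambda>i::nat. random_tangle \<Theta> X Y (int i) \<omega>); G_infty = dag_lim G
    in (\<exists>H. converges_to G H)
       \<and> G_infty = \<lparr>pverts = (\<Union>i\<in>{1..}. pverts (G i)), parcs = (\<Union>i\<in>{1..}. parcs (G i))\<rparr>
       \<and> (\<forall>v\<in>pverts G_infty. confirmed G_infty v)"
proof -
  interpret tangle_model P M h p\<Theta> I p\<epsilon> \<Theta> \<epsilon> X Y by fact
  \<comment> \<open>The vertices are countably many, so a single null set serves for all of
    them.\<close>
  have "AE \<omega> in P. \<forall>v. \<exists>n. settled (\<lambda>m. X m \<omega>) (\<lambda>m. Y m \<omega>) v (h M + Max I) n"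
    unfolding AE_all_countable by (intro allI AE_settled)
  with AE_prefix show ?thesis
  proof eventually_elim
    case (elim \<omega>)
    have G: "(\<lambda>i. random_tangle \<Theta> X Y (int i) \<omega>) = tangle_nat (\<lambda>n. \<Theta> n \<omega>) (\<lambda>n. X n \<omega>) (\<lambda>n. Y n \<omega>)"
      by (simp add: fun_eq_iff random_tangle_def tangle_def)
    note lim = tangle_limit[of "\<lambda>n. \<Theta> n \<omega>" "\<lambda>n. \<epsilon> n \<omega>" "\<lambda>n. X n \<omega>" "\<lambda>n. Y n \<omega>" "h M" "Max I"]
    show ?case
      unfolding Let_def G using lim elim dag_lim_eq[OF lim(1)] by auto
  qed
qed

end
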